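(* The family $R_\Delta$ of rewriting rules is convergent (that is, terminating and confluent) on the free $2$-category $\langle\Sigma^F\rangle$.
   Context: **The 2-polygraph $\Sigma^F$.** It has one $0$-cell, two $1$-cells $A$, $F$ and fourteen $2$-cells: $\wedge,\vee:F\otimes F\to F$; $\top,\bot:\ast\to F$; $\iota:A\to F$; $\nu:A\to A$; and, for $X,Y\in\{A,F\}$, $\delta_X:X\to X\otimes X$, $\epsilon_X:X\to\ast$, $\tau_{XY}:X\otimes Y\to Y\otimes X$. Here $\ast$ is the empty word. $\langle\Sigma^F\rangle$ is the free (strict) $2$-category it generates, i.e. the free strict monoidal category: $1$-arrows are words on $\{A,F\}$ (product $\otimes$), $2$-arrows are string diagrams built from the $2$-cells with $\otimes$ (juxtaposition) and $g\circ f$ ($f$ followed by $g$), modulo the axioms of $2$-categories. The identity $2$-arrow of a $1$-arrow $X$ is also written $X$. For a $2$-arrow $f$, $s_1(f)$ and $t_1(f)$ are its source and target words; two $2$-arrows are parallel if they have the same source and target. **Shorthands.** $\delta_\ast=\epsilon_\ast=\ast$, $\delta_{FF}=(F\otimes\tau_{FF}\otimes F)\circ(\delta_F\otimes\delta_F)$, $\epsilon_{FF}=\epsilon_F\otimes\epsilon_F$, $\tau_{\ast,X}=\tau_{X,\ast}=X$, $\tau_{FF,X}=(\tau_{FX}\otimes F)\circ(F\otimes\tau_{FX})$, $\tau_{X,FF}=(F\otimes\tau_{XF})\circ(\tau_{XF}\otimes F)$. **The family $R_\Delta$ of rewriting rules.** First family (42 rules), for all $X,Y,Z\in\{A,F\}$: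 1. $(X\otimes\delta_X)\circ\delta_X\to(\delta_X\otimes X)\circ\delta_X$ 2. $(X\otimes\tau_{XX})\circ(\delta_X\otimes X)\circ\delta_X\to(\delta_X\otimes X)\circ\delta_X$ 3. $\tau_{XX}\circ\delta_X\to\delta_X$ 4. $(\epsilon_X\otimes X)\circ\delta_X\to X$ 5. $(X\otimes\epsilon_X)\circ\delta_X\to X$ 6. $\tau_{YX}\circ\tau_{XY}\to X\otimes Y$ 7. $(Y\otimes\delta_X)\circ\tau_{XY}\to(\tau_{XY}\otimes X)\circ(X\otimes\tau_{XY})\circ(\delta_X\otimes Y)$ 8. $(Y\otimes\tau_{XY})\circ(\tau_{XY}\otimes Y)\circ(X\otimes\delta_Y)\to(\delta_Y\otimes X)\circ\tau_{XY}$ 9. $(Y\otimes\tau_{YX})\circ(\delta_Y\otimes X)\circ\tau_{XY}\to(\tau_{XY}\otimes Y)\circ(X\otimes\delta_Y)$ 10. $(\epsilon_Y\otimes X)\circ\tau_{XY}\to X\otimes\epsilon_Y$ 11. $(Y\otimes\epsilon_X)\circ\tau_{XY}\to\epsilon_X\otimes Y$ 12. $(Z\otimes\tau_{XY})\circ(\tau_{XZ}\otimes Y)\circ(X\otimes\tau_{YZ})\to(\tau_{YZ}\otimes X)\circ(Y\otimes\tau_{XZ})\circ(\tau_{XY}\otimes Z)$ Second family (36 rules), for every $\varphi\in\{\wedge,\vee,\top,\bot,\iota,\nu\}$, with $\varphi:W\to S$, and $X\in\{A,F\}$: $\tau_{SX}\circ(\varphi\otimes X)\to(X\otimes\varphi)\circ\tau_{W,X}$;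 $\tau_{XS}\circ(X\otimes\varphi)\to(\varphi\otimes X)\circ\tau_{X,W}$; $\delta_S\circ\varphi\to(\varphi\otimes\varphi)\circ\delta_W$; $\epsilon_S\circ\varphi\to\epsilon_W$. **Reduction.** For a rule $\alpha:s_2(\alpha)\to t_2(\alpha)$ between parallel $2$-arrows, $\to_\alpha$ is the smallest binary relation on parallel $2$-arrows containing $(s_2(\alpha),t_2(\alpha))$ and compatible with $\otimes$ and $\circ$ on both sides; equivalently $f\to_\alpha g$ iff $f=k\circ(Y\otimes s_2(\alpha)\otimes Z)\circ h$ and $g=k\circ(Y\otimes t_2(\alpha)\otimes Z)\circ h$ for some $h,k,Y,Z$. $\to_R$ is the union of the $\to_\alpha$, $\alpha\in R$, and $\twoheadrightarrow_R$ its reflexive-transitive closure. $R$ is terminating if there is no infinite $\to_R$-path, and confluent if $f\twoheadrightarrow_R g$ and $f\twoheadrightarrow_R h$ imply that there is $k$ with $g\twoheadrightarrow_R k$ and $h\twoheadrightarrow_R k$. *)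

theory Defs
  imports Main "HOL-Library.Confluence"
begin

datatype one_cell = A | F

text \<open>The 1-arrows are the words on the 1-cells; their product is list concatenation.\<close>

type_synonym word = "one_cell list"

datatype two_cell =
    Conj | Disj | Top | Bot | Iota | Nu
  | Delta one_cell | Eps one_cell | Tau one_cell one_cell

fun cell_src :: "two_cell \<Rightarrow> word" where
  "cell_src Conj = [F, F]"
| "cell_src Disj = [F, F]"
| "cell_src Top = []"
| "cell_src Bot = []"
| "cell_src Iota = [A]"
| "cell_src Nu = [A]"
| "cell_src (Delta X) = [X]"
| "cell_src (Eps X) = [X]"
| "cell_src (Tau X Y) = [X, Y]"

fun cell_tgt :: "two_cell \<Rightarrow> word" where
  "cell_tgt Conj = [F]"
| "cell_tgt Disj = [F]"
| "cell_tgt Top = [F]"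
| "cell_tgt Bot = [F]"
| "cell_tgt Iota = [F]"
| "cell_tgt Nu = [A]"
| "cell_tgt (Delta X) = [X, X]"
| "cell_tgt (Eps X) = []"
| "cell_tgt (Tau X Y) = [Y, X]"

section \<open>The free 2-category\<close>

text \<open>Formal composites of 2-cells; \<open>DComp g f\<close> is \<open>f\<close> followed by \<open>g\<close>.\<close>

datatype diag = DId word | DCell two_cell | DComp diag diag | DTens diag diag

fun dsrc :: "diag \<Rightarrow> word" where
  "dsrc (DId w) = w"
| "dsrc (DCell c) = cell_src c"
| "dsrc (DComp g f) = dsrc f"
| "dsrc (DTens f g) = dsrc f @ dsrc g"

fun dtgt :: "diag \<Rightarrow> word" where
  "dtgt (DId w) = w"
| "dtgt (DCell c) = cell_tgt c"
| "dtgt (DComp g f) = dtgt g"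
| "dtgt (DTens f g) = dtgt f @ dtgt g"

fun well_typed :: "diag \<Rightarrow> bool" where
  "well_typed (DId w) = True"
| "well_typed (DCell c) = True"
| "well_typed (DComp g f) = (well_typed g \<and> well_typed f \<and> dsrc g = dtgt f)"
| "well_typed (DTens f g) = (well_typed f \<and> well_typed g)"

text \<open>
  The congruence generated by the axioms of strict 2-categories (with one 0-cell). It relates
  well-typed composites only, so that it is a partial equivalence relation on \<^typ>\<open>diag\<close>.
\<close>

inductive diag_eq :: "diag \<Rightarrow> diag \<Rightarrow> bool" where
  refl: "well_typed f \<Longrightarrow> diag_eq f f"
| sym: "diag_eq f g \<Longrightarrow> diag_eq g f"
| trans: "diag_eq f g \<Longrightarrow> diag_eq g h \<Longrightarrow> diag_eq f h"
| cong_comp: "diag_eq g g' \<Longrightarrow> diag_eq f f' \<Longrightarrow> dsrc g = dtgt f \<Longrightarrow>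
    diag_eq (DComp g f) (DComp g' f')"
| cong_tens: "diag_eq f f' \<Longrightarrow> diag_eq g g' \<Longrightarrow> diag_eq (DTens f g) (DTens f' g')"
| comp_assoc: "well_typed (DComp (DComp h g) f) \<Longrightarrow>
    diag_eq (DComp (DComp h g) f) (DComp h (DComp g f))"
| comp_id_left: "well_typed f \<Longrightarrow> diag_eq (DComp (DId (dtgt f)) f) f"
| comp_id_right: "well_typed f \<Longrightarrow> diag_eq (DComp f (DId (dsrc f))) f"
| tens_assoc: "well_typed (DTens (DTens f g) h) \<Longrightarrow>
    diag_eq (DTens (DTens f g) h) (DTens f (DTens g h))"
| tens_unit_left: "well_typed f \<Longrightarrow> diag_eq (DTens (DId []) f) f"
| tens_unit_right: "well_typed f \<Longrightarrow> diag_eq (DTens f (DId [])) f"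
| tens_id: "diag_eq (DTens (DId v) (DId w)) (DId (v @ w))"
| interchange: "well_typed (DTens (DComp g f) (DComp g' f')) \<Longrightarrow>
    diag_eq (DTens (DComp g f) (DComp g' f')) (DComp (DTens g g') (DTens f f'))"

lemma diag_eq_imp:
  "diag_eq f g \<Longrightarrow> well_typed f \<and> well_typed g \<and> dsrc f = dsrc g \<and> dtgt f = dtgt g"
  by (induction rule: diag_eq.induct) auto

text \<open>The 2-arrows of the free 2-category: well-typed composites modulo the axioms.\<close>

quotient_type arrow = diag / partial: diag_eq
proof (rule part_equivpI)
  show "\<exists>f. diag_eq f f"
    by (rule exI[of _ "DId []"]) (simp add: diag_eq.refl)
  show "symp diag_eq"
    by (rule sympI) (rule diag_eq.sym)
  show "transp diag_eq"
    by (rule transpI) (rule diag_eq.trans)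
qed

lift_definition src :: "arrow \<Rightarrow> word" is dsrc
  using diag_eq_imp by blast

lift_definition tgt :: "arrow \<Rightarrow> word" is dtgt
  using diag_eq_imp by blast

lift_definition ident :: "word \<Rightarrow> arrow" is DId
  by (simp add: diag_eq.refl)

lift_definition cell :: "two_cell \<Rightarrow> arrow" is DCell
  by (simp add: diag_eq.refl)

lift_definition tens :: "arrow \<Rightarrow> arrow \<Rightarrow> arrow"  (infixl "\<otimes>" 70) is DTens
  by (rule diag_eq.cong_tens)

text \<open>
  \<open>g \<bullet> f\<close> is \<open>f\<close> followed by \<open>g\<close>. If \<open>f\<close> and \<open>g\<close> are not composable, the value is the
  arbitrary \<open>g\<close>; below, \<open>\<bullet>\<close> is only applied to composable 2-arrows.
\<close>

lift_definition vcomp :: "arrow \<Rightarrow> arrow \<Rightarrow> arrow"  (infixl "\<bullet>" 65)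
  is "\<lambda>g f. if dsrc g = dtgt f then DComp g f else g"
  using diag_eq_imp by (auto intro: diag_eq.cong_comp)

definition parallel :: "arrow \<Rightarrow> arrow \<Rightarrow> bool" where
  "parallel f g \<longleftrightarrow> src f = src g \<and> tgt f = tgt g"

section \<open>Shorthands\<close>

abbreviation idc :: "one_cell \<Rightarrow> arrow" where "idc X \<equiv> ident [X]"
abbreviation \<delta> :: "one_cell \<Rightarrow> arrow" where "\<delta> X \<equiv> cell (Delta X)"
abbreviation \<epsilon> :: "one_cell \<Rightarrow> arrow" where "\<epsilon> X \<equiv> cell (Eps X)"
abbreviation \<tau> :: "one_cell \<Rightarrow> one_cell \<Rightarrow> arrow" where "\<tau> X Y \<equiv> cell (Tau X Y)"

text \<open>
  Extensions to words, with \<open>\<tau>l w X : wX \<Rightarrow> Xw\<close> and \<open>\<tau>r X w : Xw \<Rightarrow> wX\<close>. They are only used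
  for the words \<open>[]\<close>, \<open>[A]\<close> and \<open>[F, F]\<close>.
\<close>

fun \<tau>l :: "word \<Rightarrow> one_cell \<Rightarrow> arrow" where
  "\<tau>l [] X = idc X"
| "\<tau>l [Y] X = \<tau> Y X"
| "\<tau>l (Y # Z # w) X = (\<tau> Y X \<otimes> ident (Z # w)) \<bullet> (idc Y \<otimes> \<tau>l (Z # w) X)"

fun \<tau>r :: "one_cell \<Rightarrow> word \<Rightarrow> arrow" where
  "\<tau>r X [] = idc X"
| "\<tau>r X [Y] = \<tau> X Y"
| "\<tau>r X (Y # Z # w) = (idc Y \<otimes> \<tau>r X (Z # w)) \<bullet> (\<tau> X Y \<otimes> ident (Z # w))"

fun \<delta>w :: "word \<Rightarrow> arrow" where
  "\<delta>w [] = ident []"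
| "\<delta>w [Y] = \<delta> Y"
| "\<delta>w (Y # Z # w) =
    (idc Y \<otimes> \<tau>r Y (Z # w) \<otimes> ident (Z # w)) \<bullet> (\<delta> Y \<otimes> \<delta>w (Z # w))"

fun \<epsilon>w :: "word \<Rightarrow> arrow" where
  "\<epsilon>w [] = ident []"
| "\<epsilon>w [Y] = \<epsilon> Y"
| "\<epsilon>w (Y # Z # w) = \<epsilon> Y \<otimes> \<epsilon>w (Z # w)"

section \<open>The family of rewriting rules\<close>

inductive_set R_Delta :: "(arrow \<times> arrow) set" where
  r1: "((idc X \<otimes> \<delta> X) \<bullet> \<delta> X, (\<delta> X \<otimes> idc X) \<bullet> \<delta> X) \<in> R_Delta"
| r2: "((idc X \<otimes> \<tau> X X) \<bullet> (\<delta> X \<otimes> idc X) \<bullet> \<delta> X, (\<delta> X \<otimes> idc X) \<bullet> \<delta> X) \<in> R_Delta"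
| r3: "(\<tau> X X \<bullet> \<delta> X, \<delta> X) \<in> R_Delta"
| r4: "((\<epsilon> X \<otimes> idc X) \<bullet> \<delta> X, idc X) \<in> R_Delta"
| r5: "((idc X \<otimes> \<epsilon> X) \<bullet> \<delta> X, idc X) \<in> R_Delta"
| r6: "(\<tau> Y X \<bullet> \<tau> X Y, idc X \<otimes> idc Y) \<in> R_Delta"
| r7: "((idc Y \<otimes> \<delta> X) \<bullet> \<tau> X Y,
        (\<tau> X Y \<otimes> idc X) \<bullet> (idc X \<otimes> \<tau> X Y) \<bullet> (\<delta> X \<otimes> idc Y)) \<in> R_Delta"
| r8: "((idc Y \<otimes> \<tau> X Y) \<bullet> (\<tau> X Y \<otimes> idc Y) \<bullet> (idc X \<otimes> \<delta> Y),
        (\<delta> Y \<otimes> idc X) \<bullet> \<tau> X Y) \<in> R_Delta"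
| r9: "((idc Y \<otimes> \<tau> Y X) \<bullet> (\<delta> Y \<otimes> idc X) \<bullet> \<tau> X Y,
        (\<tau> X Y \<otimes> idc Y) \<bullet> (idc X \<otimes> \<delta> Y)) \<in> R_Delta"
| r10: "((\<epsilon> Y \<otimes> idc X) \<bullet> \<tau> X Y, idc X \<otimes> \<epsilon> Y) \<in> R_Delta"
| r11: "((idc Y \<otimes> \<epsilon> X) \<bullet> \<tau> X Y, \<epsilon> X \<otimes> idc Y) \<in> R_Delta"
| r12: "((idc Z \<otimes> \<tau> X Y) \<bullet> (\<tau> X Z \<otimes> idc Y) \<bullet> (idc X \<otimes> \<tau> Y Z),
         (\<tau> Y Z \<otimes> idc X) \<bullet> (idc Y \<otimes> \<tau> X Z) \<bullet> (\<tau> X Y \<otimes> idc Z)) \<in> R_Delta"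
| nat_tau_left:
    "\<lbrakk>\<phi> \<in> {Conj, Disj, Top, Bot, Iota, Nu}; cell_src \<phi> = W; cell_tgt \<phi> = [S]\<rbrakk> \<Longrightarrow>
     (\<tau> S X \<bullet> (cell \<phi> \<otimes> idc X), (idc X \<otimes> cell \<phi>) \<bullet> \<tau>l W X) \<in> R_Delta"
| nat_tau_right:
    "\<lbrakk>\<phi> \<in> {Conj, Disj, Top, Bot, Iota, Nu}; cell_src \<phi> = W; cell_tgt \<phi> = [S]\<rbrakk> \<Longrightarrow>
     (\<tau> X S \<bullet> (idc X \<otimes> cell \<phi>), (cell \<phi> \<otimes> idc X) \<bullet> \<tau>r X W) \<in> R_Delta"
| nat_delta:
    "\<lbrakk>\<phi> \<in> {Conj, Disj, Top, Bot, Iota, Nu}; cell_src \<phi> = W; cell_tgt \<phi> = [S]\<rbrakk> \<Longrightarrow>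
     (\<delta> S \<bullet> cell \<phi>, (cell \<phi> \<otimes> cell \<phi>) \<bullet> \<delta>w W) \<in> R_Delta"
| nat_eps:
    "\<lbrakk>\<phi> \<in> {Conj, Disj, Top, Bot, Iota, Nu}; cell_src \<phi> = W; cell_tgt \<phi> = [S]\<rbrakk> \<Longrightarrow>
     (\<epsilon> S \<bullet> cell \<phi>, \<epsilon>w W) \<in> R_Delta"

lemma src_simps [simp]:
  "src (ident w) = w" "src (cell c) = cell_src c" "src (f \<otimes> g) = src f @ src g"
  "src g = tgt f \<Longrightarrow> src (g \<bullet> f) = src f"
  by (transfer, simp)+

lemma tgt_simps [simp]:
  "tgt (ident w) = w" "tgt (cell c) = cell_tgt c" "tgt (f \<otimes> g) = tgt f @ tgt g"
  "tgt (g \<bullet> f) = tgt g"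
  by (transfer, simp)+

lemma R_Delta_parallel: "(s, t) \<in> R_Delta \<Longrightarrow> parallel s t"
  by (induction rule: R_Delta.induct) (auto simp: parallel_def)

section \<open>Reduction\<close>

inductive red_rule :: "arrow \<times> arrow \<Rightarrow> arrow \<Rightarrow> arrow \<Rightarrow> bool" for \<alpha> where
  rule: "red_rule \<alpha> (fst \<alpha>) (snd \<alpha>)"
| tens_left: "red_rule \<alpha> f g \<Longrightarrow> red_rule \<alpha> (h \<otimes> f) (h \<otimes> g)"
| tens_right: "red_rule \<alpha> f g \<Longrightarrow> red_rule \<alpha> (f \<otimes> h) (g \<otimes> h)"
| comp_left: "red_rule \<alpha> f g \<Longrightarrow> src h = tgt f \<Longrightarrow> src h = tgt g \<Longrightarrow>
    red_rule \<alpha> (h \<bullet> f) (h \<bullet> g)"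
| comp_right: "red_rule \<alpha> f g \<Longrightarrow> src f = tgt h \<Longrightarrow> src g = tgt h \<Longrightarrow>
    red_rule \<alpha> (f \<bullet> h) (g \<bullet> h)"

definition red :: "(arrow \<times> arrow) set \<Rightarrow> arrow \<Rightarrow> arrow \<Rightarrow> bool" where
  "red R f g \<longleftrightarrow> (\<exists>\<alpha>\<in>R. red_rule \<alpha> f g)"

definition terminating :: "(arrow \<times> arrow) set \<Rightarrow> bool" where
  "terminating R \<longleftrightarrow> \<not> (\<exists>p :: nat \<Rightarrow> arrow. \<forall>n. red R (p n) (p (Suc n)))"

definition confluent :: "(arrow \<times> arrow) set \<Rightarrow> bool" where
  "confluent R \<longleftrightarrow> confluentp (red R)"

end

(*
  Termination. Let numbers flow down a diagram from its inputs and up from its outputs, and let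
  every structural cell emit heat depending on the currents meeting in it. The currents never
  increase under reduction, and the heat decreases strictly under every rule except rule 12 (the
  Yang-Baxter rule), which keeps it; a second interpretation decreases strictly under rule 12.

  Confluence. Interpret a 2-arrow as a list of terms over its input wires; every rule preserves this
  interpretation. It therefore suffices that every 2-arrow reduces to a 2-arrow depending only on
  its source and its list of terms. This normal form is a forest of operations, preceded by a
  structural 2-arrow that places the input wires one after another, starting with the leftmost.
*)

theory Submission
  imports Defs
begin

section \<open>Interpretations of 2-arrows\<close>

text \<open>Counting cells cannot prove termination: rule 7 turns one crossing into two, and
  naturality of \<open>\<delta>\<close> copies operations. Each cell is therefore weighed by its
  surroundings. The downward current grows at operations, which pays for the naturality rules; the
  upward current grows at \<open>\<delta>\<close>, which pays for rules 1 and 7. For confluence,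
  overlaps of string diagrams need not form a finite list of critical pairs, so none are analysed.
  Only a common reduct is produced; the chosen forms are not asserted to be irreducible. They are
  reached by two separate processes. The second family of rules moves the operations towards the
  outputs and leaves an arbitrary structural 2-arrow behind. The first family then treats that
  2-arrow on its own: it is composed with the canonical form of the identity wiring, which is itself
  an identity, and its cells are absorbed into the canonical form one at a time.\<close>

fun run :: "(two_cell \<Rightarrow> 'a list \<Rightarrow> 'a list) \<Rightarrow> diag \<Rightarrow> 'a list \<Rightarrow> 'a list" where
  "run d (DId w) xs = xs"
| "run d (DCell c) xs = d c xs"
| "run d (DComp g f) xs = run d g (run d f xs)"
| "run d (DTens f g) xs =
    run d f (take (length (dsrc f)) xs) @ run d g (drop (length (dsrc f)) xs)"

fun pull :: "(two_cell \<Rightarrow> 'a list \<Rightarrow> 'a list) \<Rightarrow> diag \<Rightarrow> 'a list \<Rightarrow> 'a list" where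
  "pull u (DId w) ys = ys"
| "pull u (DCell c) ys = u c ys"
| "pull u (DComp g f) ys = pull u f (pull u g ys)"
| "pull u (DTens f g) ys =
    pull u f (take (length (dtgt f)) ys) @ pull u g (drop (length (dtgt f)) ys)"

lemma diag_eq_rep_abs: "well_typed f \<Longrightarrow> diag_eq (rep_arrow (abs_arrow f)) f"
  by (metis Quotient3_arrow Quotient3_rep_abs diag_eq.refl)

lemma diag_eq_rep: "diag_eq (rep_arrow a) (rep_arrow a)"
  by (metis Quotient3_arrow Quotient3_rep_reflp)

lemma rep_arrow_simps [simp]:
  "well_typed (rep_arrow a)" "dsrc (rep_arrow a) = src a" "dtgt (rep_arrow a) = tgt a"
  using diag_eq_rep[of a] by (auto dest: diag_eq_imp simp: src_def tgt_def)

lemma rep_ident: "diag_eq (rep_arrow (ident w)) (DId w)"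
  by (simp add: ident_def diag_eq_rep_abs)

lemma rep_cell: "diag_eq (rep_arrow (cell c)) (DCell c)"
  by (simp add: cell_def diag_eq_rep_abs)

lemma rep_tens: "diag_eq (rep_arrow (a \<otimes> b)) (DTens (rep_arrow a) (rep_arrow b))"
  by (simp add: tens_def diag_eq_rep_abs)

lemma rep_vcomp:
  "src b = tgt a \<Longrightarrow> diag_eq (rep_arrow (b \<bullet> a)) (DComp (rep_arrow b) (rep_arrow a))"
  by (simp add: vcomp_def diag_eq_rep_abs)

locale cell_semantics =
  fixes d :: "two_cell \<Rightarrow> 'a list \<Rightarrow> 'a list"
  assumes length_d: "length xs = length (cell_src c) \<Longrightarrow> length (d c xs) = length (cell_tgt c)"
begin

lemma length_run_diag:
  "well_typed f \<Longrightarrow> length xs = length (dsrc f) \<Longrightarrow> length (run d f xs) = length (dtgt f)"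
  by (induction f arbitrary: xs) (auto simp: length_d)

lemma run_diag_eq: "diag_eq f g \<Longrightarrow> length xs = length (dsrc f) \<Longrightarrow> run d f xs = run d g xs"
proof (induction arbitrary: xs rule: diag_eq.induct)
  case (cong_comp g g' f f')
  then show ?case using diag_eq_imp[of f f'] by (simp add: length_run_diag)
next
  case (cong_tens f f' g g')
  then show ?case using diag_eq_imp[of f f'] by simp
next
  case (interchange g f g' f')
  then show ?case by (simp add: length_run_diag)
qed (auto dest: diag_eq_imp simp: take_drop drop_drop add.commute min_def)

text \<open>\<open>run\<close> is invariant under \<open>diag_eq\<close> only on lists of the right
  length, so it is not lifted to the quotient. Evaluating a chosen representative gives the expected
  equations under length conditions.\<close>

definition eval :: "arrow \<Rightarrow> 'a list \<Rightarrow> 'a list" where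
  "eval a = run d (rep_arrow a)"

lemma length_eval [simp]: "length xs = length (src a) \<Longrightarrow> length (eval a xs) = length (tgt a)"
  by (simp add: eval_def length_run_diag)

lemma eval_ident [simp]: "length xs = length w \<Longrightarrow> eval (ident w) xs = xs"
  using run_diag_eq[OF rep_ident, of xs w] by (simp add: eval_def)

lemma eval_cell [simp]: "length xs = length (cell_src c) \<Longrightarrow> eval (cell c) xs = d c xs"
  using run_diag_eq[OF rep_cell, of xs c] by (simp add: eval_def)

lemma eval_vcomp [simp]:
  "src b = tgt a \<Longrightarrow> length xs = length (src a) \<Longrightarrow> eval (b \<bullet> a) xs = eval b (eval a xs)"
  using run_diag_eq[OF rep_vcomp, of b a xs] by (simp add: eval_def)

lemma eval_tens [simp]:
  "length xs = length (src a) + length (src b) \<Longrightarrow>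
    eval (a \<otimes> b) xs = eval a (take (length (src a)) xs) @ eval b (drop (length (src a)) xs)"
  using run_diag_eq[OF rep_tens, of xs a b] by (simp add: eval_def)

end

text \<open>
  Inputs flow down through a diagram and outputs flow up; each cell emits some heat, depending
  on the currents that meet in it.
\<close>

fun emit :: "(two_cell \<Rightarrow> nat list \<Rightarrow> nat list) \<Rightarrow> (two_cell \<Rightarrow> nat list \<Rightarrow> nat list) \<Rightarrow>
    (two_cell \<Rightarrow> nat list \<Rightarrow> nat list \<Rightarrow> nat) \<Rightarrow> diag \<Rightarrow> nat list \<Rightarrow> nat list \<Rightarrow> nat" where
  "emit d u h (DId w) xs ys = 0"
| "emit d u h (DCell c) xs ys = h c xs ys"
| "emit d u h (DComp g f) xs ys = emit d u h f xs (pull u g ys) + emit d u h g (run d f xs) ys"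
| "emit d u h (DTens f g) xs ys =
    emit d u h f (take (length (dsrc f)) xs) (take (length (dtgt f)) ys) +
    emit d u h g (drop (length (dsrc f)) xs) (drop (length (dtgt f)) ys)"

abbreviation le_list :: "nat list \<Rightarrow> nat list \<Rightarrow> bool"  (infix "\<preceq>" 50) where
  "xs \<preceq> ys \<equiv> list_all2 (\<le>) xs ys"

locale heat_semantics = cell_semantics d
  for d :: "two_cell \<Rightarrow> nat list \<Rightarrow> nat list" +
  fixes u :: "two_cell \<Rightarrow> nat list \<Rightarrow> nat list"
    and h :: "two_cell \<Rightarrow> nat list \<Rightarrow> nat list \<Rightarrow> nat"
  assumes length_u: "length ys = length (cell_tgt c) \<Longrightarrow> length (u c ys) = length (cell_src c)"
    and mono_d: "xs \<preceq> xs' \<Longrightarrow> length xs = length (cell_src c) \<Longrightarrow> d c xs \<preceq> d c xs'"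
    and mono_u: "ys \<preceq> ys' \<Longrightarrow> length ys = length (cell_tgt c) \<Longrightarrow> u c ys \<preceq> u c ys'"
    and mono_h: "xs \<preceq> xs' \<Longrightarrow> ys \<preceq> ys' \<Longrightarrow> length xs = length (cell_src c) \<Longrightarrow>
      length ys = length (cell_tgt c) \<Longrightarrow> h c xs ys \<le> h c xs' ys'"
begin

lemma length_pull_diag:
  "well_typed f \<Longrightarrow> length ys = length (dtgt f) \<Longrightarrow> length (pull u f ys) = length (dsrc f)"
  by (induction f arbitrary: ys) (auto simp: length_u)

lemma pull_diag_eq: "diag_eq f g \<Longrightarrow> length ys = length (dtgt f) \<Longrightarrow> pull u f ys = pull u g ys"
proof (induction arbitrary: ys rule: diag_eq.induct)
  case (cong_comp g g' f f')
  then show ?case using diag_eq_imp[of g g'] by (simp add: length_pull_diag)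
next
  case (cong_tens f f' g g')
  then show ?case using diag_eq_imp[of f f'] by simp
next
  case (interchange g f g' f')
  then show ?case by (simp add: length_pull_diag)
qed (auto dest: diag_eq_imp simp: take_drop drop_drop add.commute min_def)

lemma emit_diag_eq:
  "diag_eq f g \<Longrightarrow> length xs = length (dsrc f) \<Longrightarrow> length ys = length (dtgt f) \<Longrightarrow>
    emit d u h f xs ys = emit d u h g xs ys"
proof (induction arbitrary: xs ys rule: diag_eq.induct)
  case (cong_comp g g' f f')
  then show ?case using diag_eq_imp[of f f'] diag_eq_imp[of g g']
    by (simp add: length_run_diag length_pull_diag run_diag_eq[of f f'] pull_diag_eq[of g g'])
next
  case (cong_tens f f' g g')
  then show ?case using diag_eq_imp[of f f'] by simp
next
  case (interchange g f g' f')
  then show ?case by (simp add: length_run_diag length_pull_diag)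
qed (auto dest: diag_eq_imp simp: take_drop drop_drop add.commute min_def)

lemma run_mono:
  "well_typed f \<Longrightarrow> xs \<preceq> xs' \<Longrightarrow> length xs = length (dsrc f) \<Longrightarrow> run d f xs \<preceq> run d f xs'"
  by (induction f arbitrary: xs xs')
    (auto simp: mono_d length_run_diag intro!: list_all2_appendI list_all2_takeI list_all2_dropI)

lemma pull_mono:
  "well_typed f \<Longrightarrow> ys \<preceq> ys' \<Longrightarrow> length ys = length (dtgt f) \<Longrightarrow> pull u f ys \<preceq> pull u f ys'"
  by (induction f arbitrary: ys ys')
    (auto simp: mono_u length_pull_diag intro!: list_all2_appendI list_all2_takeI list_all2_dropI)

lemma emit_mono:
  "well_typed f \<Longrightarrow> xs \<preceq> xs' \<Longrightarrow> ys \<preceq> ys' \<Longrightarrow> length xs = length (dsrc f) \<Longrightarrow>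
    length ys = length (dtgt f) \<Longrightarrow> emit d u h f xs ys \<le> emit d u h f xs' ys'"
  by (induction f arbitrary: xs xs' ys ys')
    (auto simp: mono_h length_run_diag length_pull_diag run_mono pull_mono
      intro!: add_mono list_all2_takeI list_all2_dropI)

definition coeval :: "arrow \<Rightarrow> nat list \<Rightarrow> nat list" where
  "coeval a = pull u (rep_arrow a)"

definition heat :: "arrow \<Rightarrow> nat list \<Rightarrow> nat list \<Rightarrow> nat" where
  "heat a = emit d u h (rep_arrow a)"

lemma length_coeval [simp]:
  "length ys = length (tgt a) \<Longrightarrow> length (coeval a ys) = length (src a)"
  by (simp add: coeval_def length_pull_diag)

lemma coeval_ident [simp]: "length ys = length w \<Longrightarrow> coeval (ident w) ys = ys"
  using pull_diag_eq[OF rep_ident, of ys w] by (simp add: coeval_def)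

lemma coeval_cell [simp]: "length ys = length (cell_tgt c) \<Longrightarrow> coeval (cell c) ys = u c ys"
  using pull_diag_eq[OF rep_cell, of ys c] by (simp add: coeval_def)

lemma coeval_vcomp [simp]:
  "src b = tgt a \<Longrightarrow> length ys = length (tgt b) \<Longrightarrow> coeval (b \<bullet> a) ys = coeval a (coeval b ys)"
  using pull_diag_eq[OF rep_vcomp, of b a ys] by (simp add: coeval_def)

lemma coeval_tens [simp]:
  "length ys = length (tgt a) + length (tgt b) \<Longrightarrow>
    coeval (a \<otimes> b) ys =
      coeval a (take (length (tgt a)) ys) @ coeval b (drop (length (tgt a)) ys)"
  using pull_diag_eq[OF rep_tens, of ys a b] by (simp add: coeval_def)

lemma heat_ident [simp]:
  "length xs = length w \<Longrightarrow> length ys = length w \<Longrightarrow> heat (ident w) xs ys = 0"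
  using emit_diag_eq[OF rep_ident, of xs w ys] by (simp add: heat_def)

lemma heat_cell [simp]:
  "length xs = length (cell_src c) \<Longrightarrow> length ys = length (cell_tgt c) \<Longrightarrow>
    heat (cell c) xs ys = h c xs ys"
  using emit_diag_eq[OF rep_cell, of xs c ys] by (simp add: heat_def)

lemma heat_vcomp [simp]:
  "src b = tgt a \<Longrightarrow> length xs = length (src a) \<Longrightarrow> length ys = length (tgt b) \<Longrightarrow>
    heat (b \<bullet> a) xs ys = heat a xs (coeval b ys) + heat b (eval a xs) ys"
  using emit_diag_eq[OF rep_vcomp, of b a xs ys] by (simp add: heat_def eval_def coeval_def)

lemma heat_tens [simp]:
  "length xs = length (src a) + length (src b) \<Longrightarrow>
   length ys = length (tgt a) + length (tgt b) \<Longrightarrow>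
    heat (a \<otimes> b) xs ys =
      heat a (take (length (src a)) xs) (take (length (tgt a)) ys) +
      heat b (drop (length (src a)) xs) (drop (length (tgt a)) ys)"
  using emit_diag_eq[OF rep_tens, of xs a b ys] by (simp add: heat_def)

lemma eval_mono: "xs \<preceq> xs' \<Longrightarrow> length xs = length (src a) \<Longrightarrow> eval a xs \<preceq> eval a xs'"
  by (simp add: eval_def run_mono)

lemma coeval_mono: "ys \<preceq> ys' \<Longrightarrow> length ys = length (tgt a) \<Longrightarrow> coeval a ys \<preceq> coeval a ys'"
  by (simp add: coeval_def pull_mono)

lemma heat_mono:
  "xs \<preceq> xs' \<Longrightarrow> ys \<preceq> ys' \<Longrightarrow> length xs = length (src a) \<Longrightarrow> length ys = length (tgt a) \<Longrightarrow>
    heat a xs ys \<le> heat a xs' ys'"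
  by (simp add: heat_def emit_mono)

text \<open>Currents are compared along with the heat because a context reacts to them. The drop
  \<open>k\<close> is demanded for all external currents, since the context decides which ones
  arrive.\<close>

definition cools :: "nat \<Rightarrow> arrow \<Rightarrow> arrow \<Rightarrow> bool" where
  "cools k a b \<longleftrightarrow> src a = src b \<and> tgt a = tgt b \<and>
    (\<forall>xs. length xs = length (src a) \<longrightarrow> eval b xs \<preceq> eval a xs) \<and>
    (\<forall>ys. length ys = length (tgt a) \<longrightarrow> coeval b ys \<preceq> coeval a ys) \<and>
    (\<forall>xs ys. length xs = length (src a) \<longrightarrow> length ys = length (tgt a) \<longrightarrow>
      heat b xs ys + k \<le> heat a xs ys)"

lemma coolsI:
  assumes "src a = src b" "tgt a = tgt b"
    and "\<And>xs. length xs = length (src a) \<Longrightarrow> eval b xs \<preceq> eval a xs"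
    and "\<And>ys. length ys = length (tgt a) \<Longrightarrow> coeval b ys \<preceq> coeval a ys"
    and "\<And>xs ys. length xs = length (src a) \<Longrightarrow> length ys = length (tgt a) \<Longrightarrow>
      heat b xs ys + k \<le> heat a xs ys"
  shows "cools k a b"
  using assms by (simp add: cools_def)

lemma coolsD:
  assumes "cools k a b"
  shows "src a = src b" "tgt a = tgt b"
    and "length xs = length (src b) \<Longrightarrow> eval b xs \<preceq> eval a xs"
    and "length ys = length (tgt b) \<Longrightarrow> coeval b ys \<preceq> coeval a ys"
    and "length xs = length (src b) \<Longrightarrow> length ys = length (tgt b) \<Longrightarrow>
      heat b xs ys + k \<le> heat a xs ys"
  using assms by (simp_all add: cools_def)

text \<open>The heat of a composite splits into that of its parts. The rewritten part loses
  \<open>k\<close>; the context receives currents that have not grown, so by monotonicity it emits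
  no more than before.\<close>

lemma cools_red_rule:
  "red_rule \<alpha> a b \<Longrightarrow> cools k (fst \<alpha>) (snd \<alpha>) \<Longrightarrow> cools k a b"
proof (induction rule: red_rule.induct)
  case (tens_left a b c)
  then have *: "cools k a b" by simp
  show ?case
    using coolsD[OF *]
    by (intro coolsI) (auto intro!: list_all2_appendI list_all2_refl simp: add.assoc)
next
  case (tens_right a b c)
  then have *: "cools k a b" by simp
  show ?case
    using coolsD[OF *]
    by (intro coolsI) (auto intro!: list_all2_appendI list_all2_refl simp: add.commute add.left_commute)
next
  case (comp_left a b c)
  then have *: "cools k a b" by simp
  note D = coolsD[OF *]
  show ?case
  proof (rule coolsI)
    fix xs :: "nat list" assume "length xs = length (src (c \<bullet> a))"
    then show "eval (c \<bullet> b) xs \<preceq> eval (c \<bullet> a) xs"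
      using comp_left D by (auto intro!: eval_mono)
  next
    fix ys :: "nat list" assume "length ys = length (tgt (c \<bullet> a))"
    then show "coeval (c \<bullet> b) ys \<preceq> coeval (c \<bullet> a) ys"
      using comp_left D by auto
  next
    fix xs ys :: "nat list" assume "length xs = length (src (c \<bullet> a))" "length ys = length (tgt (c \<bullet> a))"
    then have l: "length xs = length (src b)" "length ys = length (tgt c)"
      using comp_left D by auto
    have "heat b xs (coeval c ys) + k \<le> heat a xs (coeval c ys)"
      using comp_left D l by simp
    moreover have "heat c (eval b xs) ys \<le> heat c (eval a xs) ys"
      using comp_left D l by (intro heat_mono) (auto intro: list_all2_refl)
    ultimately show "heat (c \<bullet> b) xs ys + k \<le> heat (c \<bullet> a) xs ys"
      using comp_left(2,3) D(1,2) l by simp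
  qed (use comp_left D in auto)
next
  case (comp_right a b c)
  then have *: "cools k a b" by simp
  note D = coolsD[OF *]
  show ?case
  proof (rule coolsI)
    fix xs :: "nat list" assume "length xs = length (src (a \<bullet> c))"
    then show "eval (b \<bullet> c) xs \<preceq> eval (a \<bullet> c) xs"
      using comp_right D by auto
  next
    fix ys :: "nat list" assume "length ys = length (tgt (a \<bullet> c))"
    then show "coeval (b \<bullet> c) ys \<preceq> coeval (a \<bullet> c) ys"
      using comp_right D by (auto intro!: coeval_mono)
  next
    fix xs ys :: "nat list" assume "length xs = length (src (a \<bullet> c))" "length ys = length (tgt (a \<bullet> c))"
    then have l: "length xs = length (src c)" "length ys = length (tgt b)"
      using comp_right D by auto
    have "heat b (eval c xs) ys + k \<le> heat a (eval c xs) ys"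
      using comp_right D l by simp
    moreover have "heat c xs (coeval b ys) \<le> heat c xs (coeval a ys)"
      using comp_right D l by (intro heat_mono) (auto intro: list_all2_refl)
    ultimately show "heat (b \<bullet> c) xs ys + k \<le> heat (a \<bullet> c) xs ys"
      using comp_right(2,3) D(1,2) l by simp
  qed (use comp_right D in auto)
qed simp

end

section \<open>Termination\<close>

text \<open>
  The catch-all equations of \<open>d1\<close>, \<open>u1\<close> and \<open>h1\<close> are meant for the operations; for the structural cells they only
  give junk values on lists of the wrong length.
\<close>

fun d1 :: "two_cell \<Rightarrow> nat list \<Rightarrow> nat list" where
  "d1 (Delta X) [x] = [x, x]"
| "d1 (Eps X) _ = []"
| "d1 (Tau X Y) [x, y] = [y, x]"
| "d1 \<phi> xs = [sum_list (map Suc xs)]"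

fun u1 :: "two_cell \<Rightarrow> nat list \<Rightarrow> nat list" where
  "u1 (Delta X) [u, v] = [u + v + 2]"
| "u1 (Eps X) _ = [0]"
| "u1 (Tau X Y) [u, v] = [v, u]"
| "u1 \<phi> us = replicate (length (cell_src \<phi>)) (sum_list us)"

fun h1 :: "two_cell \<Rightarrow> nat list \<Rightarrow> nat list \<Rightarrow> nat" where
  "h1 (Delta X) [x] [u, v] = (x + 1) * (x + 1) * (v + 1)"
| "h1 (Eps X) [x] _ = x + 1"
| "h1 (Tau X Y) [x, y] [u, v] = (x + 1) * (y + 1) * (v + 1)"
| "h1 \<phi> _ _ = 0"

text \<open>Built for rule 12 alone. On inputs \<open>x, y, z\<close> its left side emits
  \<open>y + 3z + 1\<close> and its right side \<open>y + 2z\<close>, while the last output falls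
  from \<open>x + y + 2z + 3\<close> to \<open>x + y + z + 2\<close>. The \<open>+ 1\<close> keeps
  the loss \<open>z + 1\<close> positive when all currents are zero.\<close>

fun d2 :: "two_cell \<Rightarrow> nat list \<Rightarrow> nat list" where
  "d2 (Tau X Y) [x, y] = [y, x + y + 1]"
| "d2 \<phi> xs = replicate (length (cell_tgt \<phi>)) 0"

fun h2 :: "two_cell \<Rightarrow> nat list \<Rightarrow> nat list \<Rightarrow> nat" where
  "h2 (Tau X Y) [x, y] _ = y"
| "h2 \<phi> _ _ = 0"

lemma length_1: "length xs = Suc 0 \<longleftrightarrow> (\<exists>x. xs = [x])"
  by (auto simp: length_Suc_conv)

lemma length_2: "length xs = Suc (Suc 0) \<longleftrightarrow> (\<exists>x y. xs = [x, y])"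
  by (auto simp: length_Suc_conv)

lemma length_3: "length xs = Suc (Suc (Suc 0)) \<longleftrightarrow> (\<exists>x y z. xs = [x, y, z])"
  by (auto simp: length_Suc_conv)

interpretation H1: heat_semantics d1 u1 h1
proof
  fix xs xs' :: "nat list" and c assume "length xs = length (cell_src c)" "xs \<preceq> xs'"
  then show "d1 c xs \<preceq> d1 c xs'"
    by (cases c) (auto simp: length_1 length_2 list_all2_Cons1)
next
  fix ys ys' :: "nat list" and c assume "length ys = length (cell_tgt c)" "ys \<preceq> ys'"
  then show "u1 c ys \<preceq> u1 c ys'"
    by (cases c) (auto simp: length_1 length_2 list_all2_Cons1)
next
  fix xs xs' ys ys' :: "nat list" and c
  assume "xs \<preceq> xs'" "ys \<preceq> ys'" "length xs = length (cell_src c)" "length ys = length (cell_tgt c)"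
  then show "h1 c xs ys \<le> h1 c xs' ys'"
    \<comment> \<open>The products stay unexpanded so that monotonicity of multiplication applies
      factor by factor.\<close>
    by (cases c) (auto simp: length_1 length_2 list_all2_Cons1
      simp del: add_Suc_right mult_Suc mult_Suc_right intro!: mult_le_mono)
next
  fix xs :: "nat list" and c assume "length xs = length (cell_src c)"
  then show "length (d1 c xs) = length (cell_tgt c)"
    by (cases c) (auto simp: length_1 length_2)
next
  fix ys :: "nat list" and c assume "length ys = length (cell_tgt c)"
  then show "length (u1 c ys) = length (cell_src c)"
    by (cases c) (auto simp: length_1 length_2)
qed

interpretation H2: heat_semantics d2 "\<lambda>c ys. replicate (length (cell_src c)) 0" h2
proof
  fix xs xs' :: "nat list" and c assume "length xs = length (cell_src c)" "xs \<preceq> xs'"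
  then show "d2 c xs \<preceq> d2 c xs'"
    by (cases c) (auto simp: length_1 length_2 list_all2_Cons1)
next
  fix xs xs' ys ys' :: "nat list" and c
  assume "xs \<preceq> xs'" "ys \<preceq> ys'" "length xs = length (cell_src c)" "length ys = length (cell_tgt c)"
  then show "h2 c xs ys \<le> h2 c xs' ys'"
    by (cases c) (auto simp: length_1 length_2 list_all2_Cons1)
next
  fix xs :: "nat list" and c assume "length xs = length (cell_src c)"
  then show "length (d2 c xs) = length (cell_tgt c)"
    by (cases c) (auto simp: length_1 length_2)
qed (auto intro: list_all2_refl)

definition yang_baxter :: "one_cell \<Rightarrow> one_cell \<Rightarrow> one_cell \<Rightarrow> arrow \<times> arrow" where
  "yang_baxter X Y Z =
    ((idc Z \<otimes> \<tau> X Y) \<bullet> (\<tau> X Z \<otimes> idc Y) \<bullet> (idc X \<otimes> \<tau> Y Z),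
     (\<tau> Y Z \<otimes> idc X) \<bullet> (idc Y \<otimes> \<tau> X Z) \<bullet> (\<tau> X Y \<otimes> idc Z))"

lemma H1_cools_yang_baxter: "H1.cools 0 (fst (yang_baxter X Y Z)) (snd (yang_baxter X Y Z))"
  by (rule H1.coolsI) (auto simp: yang_baxter_def length_3)

lemma H2_cools_yang_baxter: "H2.cools 1 (fst (yang_baxter X Y Z)) (snd (yang_baxter X Y Z))"
  by (rule H2.coolsI) (auto simp: yang_baxter_def length_3)

text \<open>A crossing is weighed by the upward current of the strand that leaves it on the right
  only. Rule 7 distributes it over a \<open>\<delta>\<close> on that strand, and
  \<open>(u + v + 2) + 1\<close> exceeds \<open>(u + 1) + (v + 1)\<close> by one: hence the 2 in
  \<open>u1\<close>. The other strand's upward current does not count, so rule 8 simply loses a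
  crossing. A binary operation sends down \<open>x + y + 2\<close>, and
  \<open>(x + y + 2) + 1\<close> exceeds \<open>(x + 1) + (y + 1)\<close>: hence \<open>Suc\<close>
  in \<open>d1\<close>. Copying a binary operation yields two \<open>\<delta>\<close> and a
  crossing, with \<open>(x+1)^2 + (y+1)^2 + (x+1)(y+1) < (x+y+3)^2\<close>: hence the square in
  \<open>h1\<close>.\<close>

lemma H1_cools_rule:
  assumes "(s, t) \<in> R_Delta"
  shows "(\<exists>X Y Z. (s, t) = yang_baxter X Y Z) \<or> H1.cools 1 s t"
  using assms
proof (cases rule: R_Delta.cases)
  case (r12 Z X Y)
  then show ?thesis by (auto simp: yang_baxter_def)
next
  case (nat_tau_left \<phi> W S X)
  then have "H1.cools 1 s t"
    by (cases \<phi>; clarsimp; intro H1.coolsI)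
      (auto simp: length_1 length_2 length_3 algebra_simps)
  then show ?thesis ..
next
  case (nat_tau_right \<phi> W S X)
  then have "H1.cools 1 s t"
    by (cases \<phi>; clarsimp; intro H1.coolsI)
      (auto simp: length_1 length_2 length_3 algebra_simps)
  then show ?thesis ..
next
  case (nat_delta \<phi> W S)
  then have "H1.cools 1 s t"
    by (cases \<phi>; clarsimp; intro H1.coolsI)
      (auto simp: length_1 length_2 length_3 algebra_simps)
  then show ?thesis ..
next
  case (nat_eps \<phi> W S)
  then have "H1.cools 1 s t"
    by (cases \<phi>; clarsimp; intro H1.coolsI)
      (auto simp: length_1 length_2 length_3 algebra_simps)
  then show ?thesis ..
qed (auto intro!: H1.coolsI disjI2 simp: length_1 length_2 length_3 numeral_2_eq_2 algebra_simps)

lemma terminating_R_Delta: "terminating R_Delta"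
proof -
  define m where "m a = (H1.heat a (replicate (length (src a)) 0) (replicate (length (tgt a)) 0),
    H2.heat a (replicate (length (src a)) 0) (replicate (length (tgt a)) 0))" for a
  have "(m b, m a) \<in> less_than <*lex*> less_than" if "red R_Delta a b" for a b
  proof -
    from that obtain \<alpha> where \<alpha>: "\<alpha> \<in> R_Delta" "red_rule \<alpha> a b" by (auto simp: red_def)
    from \<alpha>(1) H1_cools_rule[of "fst \<alpha>" "snd \<alpha>"]
    have "(\<exists>X Y Z. \<alpha> = yang_baxter X Y Z) \<or> H1.cools 1 (fst \<alpha>) (snd \<alpha>)" by simp
    then show ?thesis
    proof
      assume "H1.cools 1 (fst \<alpha>) (snd \<alpha>)"
      then have *: "H1.cools 1 a b" by (rule H1.cools_red_rule[OF \<alpha>(2)])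
      show ?thesis
        using H1.coolsD(1,2)[OF *]
          H1.coolsD(5)[OF *, of "replicate (length (src b)) 0" "replicate (length (tgt b)) 0"]
        by (simp add: m_def)
    next
      assume "\<exists>X Y Z. \<alpha> = yang_baxter X Y Z"
      \<comment> \<open>\<open>cools 0\<close> bounds the first component only weakly; whether it
        stays or falls, the strict drop of the second makes the pair decrease.\<close>
      then have *: "H1.cools 0 a b" "H2.cools 1 a b"
        using H1.cools_red_rule[OF \<alpha>(2)] H2.cools_red_rule[OF \<alpha>(2)]
          H1_cools_yang_baxter H2_cools_yang_baxter by blast+
      show ?thesis
        using H1.coolsD(1,2)[OF *(1)]
          H1.coolsD(5)[OF *(1), of "replicate (length (src b)) 0" "replicate (length (tgt b)) 0"]
          H2.coolsD(5)[OF *(2), of "replicate (length (src b)) 0" "replicate (length (tgt b)) 0"]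
        by (auto simp add: m_def)
    qed
  qed
  moreover have "wf (inv_image (less_than <*lex*> less_than) m)" by auto
  ultimately show ?thesis
    unfolding terminating_def wf_iff_no_infinite_down_chain by (metis in_inv_image)
qed

section \<open>The strict monoidal structure\<close>

lemma vcomp_assoc:
  "src c = tgt b \<Longrightarrow> src b = tgt a \<Longrightarrow> c \<bullet> b \<bullet> a = c \<bullet> (b \<bullet> a)"
  by transfer (auto dest!: diag_eq_imp intro: diag_eq.comp_assoc)

lemma vcomp_ident_left [simp]: "tgt a = w \<Longrightarrow> ident w \<bullet> a = a"
  by transfer (auto dest!: diag_eq_imp intro: diag_eq.comp_id_left)

lemma vcomp_ident_right [simp]: "src a = w \<Longrightarrow> a \<bullet> ident w = a"
  by transfer (auto dest!: diag_eq_imp intro: diag_eq.comp_id_right)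

lemma tens_assoc: "a \<otimes> b \<otimes> c = a \<otimes> (b \<otimes> c)"
  by transfer (auto dest!: diag_eq_imp intro: diag_eq.tens_assoc)

lemma tens_ident_Nil_left [simp]: "ident [] \<otimes> a = a"
  by transfer (auto dest!: diag_eq_imp intro: diag_eq.tens_unit_left)

lemma tens_ident_Nil_right [simp]: "a \<otimes> ident [] = a"
  by transfer (auto dest!: diag_eq_imp intro: diag_eq.tens_unit_right)

lemma tens_ident [simp]: "ident v \<otimes> ident w = ident (v @ w)"
  by transfer (auto intro: diag_eq.tens_id)

lemma tens_ident_ident [simp]: "ident v \<otimes> (ident w \<otimes> a) = ident (v @ w) \<otimes> a"
  by (simp flip: tens_assoc)

lemma interchange:
  "src b = tgt a \<Longrightarrow> src b' = tgt a' \<Longrightarrow> (b \<bullet> a) \<otimes> (b' \<bullet> a') = (b \<otimes> b') \<bullet> (a \<otimes> a')"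
  by transfer (auto dest!: diag_eq_imp intro!: diag_eq.interchange)

lemma tens_vcomp_ident: "src b = tgt a \<Longrightarrow> (b \<bullet> a) \<otimes> ident w = (b \<otimes> ident w) \<bullet> (a \<otimes> ident w)"
  using interchange[of b a "ident w" "ident w"] by simp

lemma ident_tens_vcomp: "src b = tgt a \<Longrightarrow> ident w \<otimes> (b \<bullet> a) = (ident w \<otimes> b) \<bullet> (ident w \<otimes> a)"
  using interchange[of "ident w" "ident w" b a] by simp

text \<open>These rules bring an expression into the form of a right-nested composite of slices.\<close>

lemmas slicing = vcomp_assoc tens_assoc tens_vcomp_ident ident_tens_vcomp

lemma slide: "(a \<otimes> ident (tgt b)) \<bullet> (ident (src a) \<otimes> b) = a \<otimes> b"
  using interchange[of a "ident (src a)" "ident (tgt b)" b] by simp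

lemma slide': "(ident (tgt a) \<otimes> b) \<bullet> (a \<otimes> ident (src b)) = a \<otimes> b"
  using interchange[of "ident (tgt a)" a b "ident (src b)"] by simp

section \<open>Reduction sequences\<close>

abbreviation reds :: "arrow \<Rightarrow> arrow \<Rightarrow> bool"  (infix "\<leadsto>" 50) where
  "a \<leadsto> b \<equiv> (red R_Delta)\<^sup>*\<^sup>* a b"

lemma red_rule_parallel: "red_rule \<alpha> a b \<Longrightarrow> parallel (fst \<alpha>) (snd \<alpha>) \<Longrightarrow> parallel a b"
  by (induction rule: red_rule.induct) (auto simp: parallel_def)

lemma red_parallel: "red R_Delta a b \<Longrightarrow> src a = src b \<and> tgt a = tgt b"
  unfolding red_def by (auto dest!: red_rule_parallel simp: parallel_def R_Delta_parallel[unfolded parallel_def])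

lemma reds_parallel: "a \<leadsto> b \<Longrightarrow> src a = src b \<and> tgt a = tgt b"
  by (induction rule: rtranclp_induct) (auto dest: red_parallel)

lemma reds_tens_left: "a \<leadsto> b \<Longrightarrow> c \<otimes> a \<leadsto> c \<otimes> b"
  by (induction rule: rtranclp_induct)
    (auto simp: red_def intro: red_rule.tens_left rtranclp.rtrancl_into_rtrancl)

lemma reds_tens_right: "a \<leadsto> b \<Longrightarrow> a \<otimes> c \<leadsto> b \<otimes> c"
  by (induction rule: rtranclp_induct)
    (auto simp: red_def intro: red_rule.tens_right rtranclp.rtrancl_into_rtrancl)

lemma reds_vcomp_left: "a \<leadsto> b \<Longrightarrow> src c = tgt a \<Longrightarrow> c \<bullet> a \<leadsto> c \<bullet> b"
proof (induction rule: rtranclp_induct)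
  case (step b b')
  then have "tgt b = tgt a" "tgt b' = tgt a" using reds_parallel red_parallel by metis+
  with step have "red R_Delta (c \<bullet> b) (c \<bullet> b')"
    unfolding red_def by (metis red_rule.comp_left)
  with step show ?case by (auto intro: rtranclp.rtrancl_into_rtrancl)
qed simp

lemma reds_vcomp_right: "a \<leadsto> b \<Longrightarrow> src a = tgt c \<Longrightarrow> a \<bullet> c \<leadsto> b \<bullet> c"
proof (induction rule: rtranclp_induct)
  case (step b b')
  then have "src b = src a" "src b' = src a" using reds_parallel red_parallel by metis+
  with step have "red R_Delta (b \<bullet> c) (b' \<bullet> c)"
    unfolding red_def by (metis red_rule.comp_right)
  with step show ?case by (auto intro: rtranclp.rtrancl_into_rtrancl)
qed simp

lemma reds_trans [trans]: "a \<leadsto> b \<Longrightarrow> b \<leadsto> c \<Longrightarrow> a \<leadsto> c"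
  by (rule rtranclp_trans)

lemma eq_reds_trans [trans]: "a = b \<Longrightarrow> b \<leadsto> c \<Longrightarrow> a \<leadsto> c"
  by simp

lemma reds_eq_trans [trans]: "a \<leadsto> b \<Longrightarrow> b = c \<Longrightarrow> a \<leadsto> c"
  by simp

lemma reds_rule: "(a, b) \<in> R_Delta \<Longrightarrow> a \<leadsto> b"
  using red_rule.rule[of "(a, b)"] by (intro r_into_rtranclp) (auto simp: red_def)

text \<open>The cell being rewritten below always acts on the rightmost wires, so identity wires are
  added on its left only.\<close>

lemma reds_in_context:
  assumes "(s, t) \<in> R_Delta" "src k = v @ tgt s" "tgt h = v @ src s"
  shows "k \<bullet> ((ident v \<otimes> s) \<bullet> h) \<leadsto> k \<bullet> ((ident v \<otimes> t) \<bullet> h)"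
  using assms(2,3) R_Delta_parallel[OF assms(1)]
  by (intro reds_vcomp_left reds_vcomp_right reds_tens_left reds_rule assms(1))
    (auto simp: parallel_def)

section \<open>Normal forms of structural 2-arrows\<close>

text \<open>
  A structural 2-arrow is determined by the function that maps each output wire to an input wire.
  Wires are numbered; the list of the wires at the outputs is kept in reverse, so that its head
  is the rightmost output.
\<close>

context
  fixes C :: "nat \<Rightarrow> one_cell"
begin

definition wires :: "nat list \<Rightarrow> word" where
  "wires rf = map C (rev rf)"

lemma wires_simps [simp]:
  "wires [] = []" "wires (k # rf) = wires rf @ [C k]" "wires (rf @ rf') = wires rf' @ wires rf"
  by (simp_all add: wires_def)

text \<open>
  \<open>place n rf\<close> moves the wire \<open>n\<close>, which enters at the right, to its positions in \<open>rf\<close>.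
\<close>

fun place :: "nat \<Rightarrow> nat list \<Rightarrow> arrow" where
  "place n [] = \<epsilon> (C n)"
| "place n (k # rf) =
    (if n \<notin> set (k # rf) then ident (wires (k # rf)) \<otimes> \<epsilon> (C n)
     else if k \<noteq> n then
       (place n rf \<otimes> idc (C k)) \<bullet> (ident (wires (filter (\<lambda>i. i \<noteq> n) rf)) \<otimes> \<tau> (C k) (C n))
     else if n \<in> set rf then
       (place n rf \<otimes> idc (C n)) \<bullet> (ident (wires (filter (\<lambda>i. i \<noteq> n) rf)) \<otimes> \<delta> (C n))
     else ident (wires (k # rf)))"

lemma filter_neq_id: "n \<notin> set rf \<Longrightarrow> filter (\<lambda>i. i \<noteq> n) rf = rf"
  by (simp add: filter_id_conv) blast

lemma place_notin: "n \<notin> set rf \<Longrightarrow> place n rf = ident (wires rf) \<otimes> \<epsilon> (C n)"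
  by (cases rf) simp_all

lemma place_typing [simp]:
  "src (place n rf) = wires (filter (\<lambda>i. i \<noteq> n) rf) @ [C n]" "tgt (place n rf) = wires rf"
  by (induction rf) (auto simp: filter_neq_id)

declare place.simps(2) [simp del]

lemma place_neq: "n \<in> set rf \<Longrightarrow> k \<noteq> n \<Longrightarrow> place n (k # rf) =
    (place n rf \<otimes> idc (C k)) \<bullet> (ident (wires (filter (\<lambda>i. i \<noteq> n) rf)) \<otimes> \<tau> (C k) (C n))"
  by (simp add: place.simps)

lemma place_dup: "n \<in> set rf \<Longrightarrow> place n (n # rf) =
    (place n rf \<otimes> idc (C n)) \<bullet> (ident (wires (filter (\<lambda>i. i \<noteq> n) rf)) \<otimes> \<delta> (C n))"
  by (simp add: place.simps)

lemma place_last: "n \<notin> set rf \<Longrightarrow> place n (n # rf) = ident (wires (n # rf))"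
  by (simp add: place.simps)

text \<open>At most one structural cell beside identity wires. The cell sits at the right end and
  \<open>tens\<close> adds wires to its right, matching the recursion of \<open>place\<close> on the
  head of the reversed list. The identity is included because a cell absorbed by the placement of a
  wire leaves nothing behind.\<close>

inductive slice :: "arrow \<Rightarrow> nat list \<Rightarrow> nat list \<Rightarrow> bool" where
  eps: "slice (ident (wires rf) \<otimes> \<epsilon> (C k)) (k # rf) rf"
| delta: "slice (ident (wires rf) \<otimes> \<delta> (C k)) (k # rf) (k # k # rf)"
| tau: "slice (ident (wires rf) \<otimes> \<tau> (C l) (C k)) (k # l # rf) (l # k # rf)"
| ident: "slice (ident (wires rf)) rf rf"
| tens: "slice s rf rf' \<Longrightarrow> slice (s \<otimes> idc (C k)) (k # rf) (k # rf')"

lemma slice_typing: "slice s rf rf' \<Longrightarrow> src s = wires rf \<and> tgt s = wires rf' \<and> set rf' \<subseteq> set rf"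
  by (induction rule: slice.induct) auto

text \<open>Here the placement is a bare \<open>\<epsilon>\<close> to the right of everything
  \<open>s\<close> touches, so interchange gives an equality without rewriting.\<close>

lemma slice_place_notin:
  assumes "slice s rf rf'" "n \<notin> set rf"
  shows "s \<bullet> place n rf = place n rf' \<bullet> (s \<otimes> idc (C n))"
proof -
  have "n \<notin> set rf'" using slice_typing[OF assms(1)] assms(2) by blast
  then show ?thesis
    using slide[of s "\<epsilon> (C n)"] slide'[of s "\<epsilon> (C n)"] slice_typing[OF assms(1)] assms(2)
    by (simp add: place_notin)
qed

lemma slide_place:
  assumes "src s = x"
  shows "(ident (wires rf) \<otimes> s) \<bullet> (place n rf \<otimes> ident x) =
    (place n rf \<otimes> ident (tgt s)) \<bullet> (ident (wires (filter (\<lambda>i. i \<noteq> n) rf) @ [C n]) \<otimes> s)"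
  using slide[of "place n rf" s] slide'[of "place n rf" s] assms by simp

lemma slide_place_vcomp:
  assumes "src s = x" "tgt y = wires (filter (\<lambda>i. i \<noteq> n) rf) @ C n # x"
  shows "(ident (wires rf) \<otimes> s) \<bullet> ((place n rf \<otimes> ident x) \<bullet> y) =
    (place n rf \<otimes> ident (tgt s)) \<bullet> ((ident (wires (filter (\<lambda>i. i \<noteq> n) rf) @ [C n]) \<otimes> s) \<bullet> y)"
  using slide_place[of s x rf n] assms by (simp flip: vcomp_assoc)

text \<open>The core of the structural part: a slice passes through the placement of wire
  \<open>n\<close>, and its residue \<open>s'\<close> acts on the other wires only. The cases ask
  which wires at the cell are copies of \<open>n\<close> and whether \<open>n\<close> occurs further
  left. Those that are not plain equalities call for rules 1 to 12, each exactly once.\<close>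

lemma slice_place:
  "slice s rf rf' \<Longrightarrow> \<exists>s'. slice s' (filter (\<lambda>i. i \<noteq> n) rf) (filter (\<lambda>i. i \<noteq> n) rf') \<and>
    s \<bullet> place n rf \<leadsto> place n rf' \<bullet> (s' \<otimes> idc (C n))"
proof (induction rule: slice.induct)
  case (eps rf k)
  let ?v = "wires (filter (\<lambda>i. i \<noteq> n) rf)"
  consider "n \<notin> set (k # rf)" | "n \<in> set rf" "k \<noteq> n" | "n \<in> set rf" "k = n" | "n \<notin> set rf" "k = n"
    by fastforce
  then show ?case
  proof cases
    case 1
    then show ?thesis
      using slice_place_notin[OF slice.eps 1] slice.eps by (auto simp: filter_neq_id)
  next
    case 2
    have "(ident (wires rf) \<otimes> \<epsilon> (C k)) \<bullet> place n (k # rf) =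
       place n rf \<bullet> ((ident ?v \<otimes> ((idc (C n) \<otimes> \<epsilon> (C k)) \<bullet> \<tau> (C k) (C n))) \<bullet> ident (?v @ [C k, C n]))"
      using 2 by (simp add: place_neq slicing slide_place_vcomp)
    also have "\<dots> \<leadsto> place n rf \<bullet> ((ident ?v \<otimes> (\<epsilon> (C k) \<otimes> idc (C n))) \<bullet> ident (?v @ [C k, C n]))"
      by (rule reds_in_context) (auto intro: R_Delta.r11)
    finally show ?thesis using 2
      by (intro exI[of _ "ident ?v \<otimes> \<epsilon> (C k)"]) (auto simp: slicing slice.intros)
  next
    case 3
    have "(ident (wires rf) \<otimes> \<epsilon> (C k)) \<bullet> place n (k # rf) =
       place n rf \<bullet> ((ident ?v \<otimes> ((idc (C n) \<otimes> \<epsilon> (C n)) \<bullet> \<delta> (C n))) \<bullet> ident (?v @ [C n]))"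
      using 3 by (simp add: place_dup slicing slide_place_vcomp)
    also have "\<dots> \<leadsto> place n rf \<bullet> ((ident ?v \<otimes> idc (C n)) \<bullet> ident (?v @ [C n]))"
      by (rule reds_in_context) (auto intro: R_Delta.r5)
    finally show ?thesis using 3
      by (intro exI[of _ "ident ?v"]) (auto simp: slicing slice.intros)
  next
    case 4
    then show ?thesis
      by (intro exI[of _ "ident ?v"])
        (auto simp: slicing slice.intros place_notin place_last filter_neq_id)
  qed
next
  case (delta rf k)
  let ?v = "wires (filter (\<lambda>i. i \<noteq> n) rf)"
  consider "n \<notin> set (k # rf)" | "n \<in> set rf" "k \<noteq> n" | "n \<in> set rf" "k = n" | "n \<notin> set rf" "k = n"
    by fastforce
  then show ?case
  proof cases
    case 1
    then show ?thesis
      using slice_place_notin[OF slice.delta 1] slice.delta by (auto simp: filter_neq_id)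
  next
    case 2
    let ?p = "place n rf \<otimes> ident [C k, C k]"
    have "(ident (wires rf) \<otimes> \<delta> (C k)) \<bullet> place n (k # rf) =
       ?p \<bullet> ((ident ?v \<otimes> ((idc (C n) \<otimes> \<delta> (C k)) \<bullet> \<tau> (C k) (C n))) \<bullet> ident (?v @ [C k, C n]))"
      using 2 by (simp add: place_neq slicing slide_place_vcomp)
    also have "\<dots> \<leadsto> ?p \<bullet> ((ident ?v \<otimes> ((\<tau> (C k) (C n) \<otimes> idc (C k)) \<bullet> (idc (C k) \<otimes> \<tau> (C k) (C n)) \<bullet>
        (\<delta> (C k) \<otimes> idc (C n)))) \<bullet> ident (?v @ [C k, C n]))"
      by (rule reds_in_context) (auto intro: R_Delta.r7)
    finally show ?thesis using 2
      by (intro exI[of _ "ident ?v \<otimes> \<delta> (C k)"]) (auto simp: slicing slice.intros place_neq)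
  next
    case 3
    let ?p = "place n rf \<otimes> ident [C n, C n]"
    have "(ident (wires rf) \<otimes> \<delta> (C k)) \<bullet> place n (k # rf) =
       ?p \<bullet> ((ident ?v \<otimes> ((idc (C n) \<otimes> \<delta> (C n)) \<bullet> \<delta> (C n))) \<bullet> ident (?v @ [C n]))"
      using 3 by (simp add: place_dup slicing slide_place_vcomp)
    also have "\<dots> \<leadsto> ?p \<bullet> ((ident ?v \<otimes> ((\<delta> (C n) \<otimes> idc (C n)) \<bullet> \<delta> (C n))) \<bullet> ident (?v @ [C n]))"
      by (rule reds_in_context) (auto intro: R_Delta.r1)
    finally show ?thesis using 3
      by (intro exI[of _ "ident ?v"]) (auto simp: slicing slice.intros place_dup)
  next
    \<comment> \<open>There is one copy of \<open>n\<close>, already in place, so the new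
      \<open>\<delta>\<close> is itself the placement of two copies.\<close>
    case 4
    then show ?thesis
      by (intro exI[of _ "ident ?v"])
        (auto simp: slicing slice.intros place_dup place_last filter_neq_id)
  qed
next
  case (tau rf l k)
  let ?v = "wires (filter (\<lambda>i. i \<noteq> n) rf)"
  consider "n \<notin> set (k # l # rf)" | "n \<in> set rf" "k \<noteq> n" "l \<noteq> n"
    | "n \<in> set rf" "k = n" "l \<noteq> n" | "n \<notin> set rf" "k = n" "l \<noteq> n"
    | "n \<in> set rf" "k \<noteq> n" "l = n" | "n \<notin> set rf" "k \<noteq> n" "l = n"
    | "n \<in> set rf" "k = n" "l = n" | "n \<notin> set rf" "k = n" "l = n"
    by fastforce
  then show ?case
  proof cases
    case 1
    then show ?thesis
      using slice_place_notin[OF slice.tau 1] slice.tau by (auto simp: filter_neq_id)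
  next
    case 2
    let ?p = "place n rf \<otimes> ident [C k, C l]"
    have "(ident (wires rf) \<otimes> \<tau> (C l) (C k)) \<bullet> place n (k # l # rf) =
       ?p \<bullet> ((ident ?v \<otimes> ((idc (C n) \<otimes> \<tau> (C l) (C k)) \<bullet> (\<tau> (C l) (C n) \<otimes> idc (C k)) \<bullet>
         (idc (C l) \<otimes> \<tau> (C k) (C n)))) \<bullet> ident (?v @ [C l, C k, C n]))"
      using 2 by (simp add: place_neq slicing slide_place_vcomp)
    also have "\<dots> \<leadsto> ?p \<bullet> ((ident ?v \<otimes> ((\<tau> (C k) (C n) \<otimes> idc (C l)) \<bullet> (idc (C k) \<otimes> \<tau> (C l) (C n)) \<bullet>
        (\<tau> (C l) (C k) \<otimes> idc (C n)))) \<bullet> ident (?v @ [C l, C k, C n]))"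
      by (rule reds_in_context) (auto intro: R_Delta.r12)
    finally show ?thesis using 2
      by (intro exI[of _ "ident ?v \<otimes> \<tau> (C l) (C k)"]) (auto simp: slicing slice.intros place_neq)
  next
    case 3
    let ?p = "place n rf \<otimes> ident [C n, C l]"
    have "(ident (wires rf) \<otimes> \<tau> (C l) (C k)) \<bullet> place n (k # l # rf) =
       ?p \<bullet> ((ident ?v \<otimes> ((idc (C n) \<otimes> \<tau> (C l) (C n)) \<bullet> (\<tau> (C l) (C n) \<otimes> idc (C n)) \<bullet>
         (idc (C l) \<otimes> \<delta> (C n)))) \<bullet> ident (?v @ [C l, C n]))"
      using 3 by (simp add: place_neq place_dup slicing slide_place_vcomp)
    also have "\<dots> \<leadsto> ?p \<bullet> ((ident ?v \<otimes> ((\<delta> (C n) \<otimes> idc (C l)) \<bullet> \<tau> (C l) (C n))) \<bullet> ident (?v @ [C l, C n]))"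
      by (rule reds_in_context) (auto intro: R_Delta.r8)
    finally show ?thesis using 3
      by (intro exI[of _ "ident (?v @ [C l])"])
        (auto simp: slicing place_neq place_dup intro: slice.ident[of "l # filter (\<lambda>i. i \<noteq> n) rf", simplified])
  next
    case 4
    then show ?thesis
      by (intro exI[of _ "ident (?v @ [C l])"])
        (auto simp: slicing place_neq place_last filter_neq_id intro: slice.ident[of "l # rf", simplified])
  next
    case 5
    let ?p = "place n rf \<otimes> ident [C k, C n]"
    have "(ident (wires rf) \<otimes> \<tau> (C l) (C k)) \<bullet> place n (k # l # rf) =
       ?p \<bullet> ((ident ?v \<otimes> ((idc (C n) \<otimes> \<tau> (C n) (C k)) \<bullet> (\<delta> (C n) \<otimes> idc (C k)) \<bullet>
         \<tau> (C k) (C n))) \<bullet> ident (?v @ [C k, C n]))"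
      using 5 by (simp add: place_neq place_dup slicing slide_place_vcomp)
    also have "\<dots> \<leadsto> ?p \<bullet> ((ident ?v \<otimes> ((\<tau> (C k) (C n) \<otimes> idc (C n)) \<bullet> (idc (C k) \<otimes> \<delta> (C n)))) \<bullet>
        ident (?v @ [C k, C n]))"
      by (rule reds_in_context) (auto intro: R_Delta.r9)
    finally show ?thesis using 5
      by (intro exI[of _ "ident (?v @ [C k])"])
        (auto simp: slicing place_neq place_dup intro: slice.ident[of "k # filter (\<lambda>i. i \<noteq> n) rf", simplified])
  next
    case 6
    let ?p = "ident (wires (n # k # rf))"
    have "(ident (wires rf) \<otimes> \<tau> (C l) (C k)) \<bullet> place n (k # l # rf) =
       ?p \<bullet> ((ident (wires rf) \<otimes> (\<tau> (C n) (C k) \<bullet> \<tau> (C k) (C n))) \<bullet> ident (wires rf @ [C k, C n]))"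
      using 6 by (simp add: place_neq place_last slicing filter_neq_id)
    also have "\<dots> \<leadsto> ?p \<bullet> ((ident (wires rf) \<otimes> (idc (C k) \<otimes> idc (C n))) \<bullet> ident (wires rf @ [C k, C n]))"
      \<comment> \<open>\<open>tens_ident\<close> would merge the two identities and hide the
        literal right side of rule 6.\<close>
      by (rule reds_in_context) (auto simp del: tens_ident intro: R_Delta.r6)
    finally show ?thesis using 6
      by (intro exI[of _ "ident (wires (k # rf))"])
        (auto simp: slicing place_last filter_neq_id intro: slice.ident[of "k # rf", simplified])
  next
    case 7
    let ?p = "place n rf \<otimes> ident [C n, C n]"
    have "(ident (wires rf) \<otimes> \<tau> (C l) (C k)) \<bullet> place n (k # l # rf) =
       ?p \<bullet> ((ident ?v \<otimes> ((idc (C n) \<otimes> \<tau> (C n) (C n)) \<bullet> (\<delta> (C n) \<otimes> idc (C n)) \<bullet>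
         \<delta> (C n))) \<bullet> ident (?v @ [C n]))"
      using 7 by (simp add: place_dup slicing slide_place_vcomp)
    also have "\<dots> \<leadsto> ?p \<bullet> ((ident ?v \<otimes> ((\<delta> (C n) \<otimes> idc (C n)) \<bullet> \<delta> (C n))) \<bullet> ident (?v @ [C n]))"
      by (rule reds_in_context) (auto intro: R_Delta.r2)
    finally show ?thesis using 7
      by (intro exI[of _ "ident ?v"]) (auto simp: slicing place_dup slice.intros)
  next
    case 8
    let ?p = "ident (wires (n # n # rf))"
    have "(ident (wires rf) \<otimes> \<tau> (C l) (C k)) \<bullet> place n (k # l # rf) =
       ?p \<bullet> ((ident (wires rf) \<otimes> (\<tau> (C n) (C n) \<bullet> \<delta> (C n))) \<bullet> ident (wires rf @ [C n]))"
      using 8 by (simp add: place_dup place_last slicing filter_neq_id)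
    also have "\<dots> \<leadsto> ?p \<bullet> ((ident (wires rf) \<otimes> \<delta> (C n)) \<bullet> ident (wires rf @ [C n]))"
      by (rule reds_in_context) (auto intro: R_Delta.r3)
    finally show ?thesis using 8
      by (intro exI[of _ "ident (wires rf)"])
        (auto simp: slicing place_dup place_last filter_neq_id slice.intros)
  qed
next
  case (ident rf)
  show ?case
    by (intro exI[of _ "ident (wires (filter (\<lambda>i. i \<noteq> n) rf))"]) (auto intro: slice.ident)
next
  case (tens s rf rf' k)
  then obtain s' where s': "slice s' (filter (\<lambda>i. i \<noteq> n) rf) (filter (\<lambda>i. i \<noteq> n) rf')"
    and IH: "s \<bullet> place n rf \<leadsto> place n rf' \<bullet> (s' \<otimes> idc (C n))" by blast
  let ?v = "wires (filter (\<lambda>i. i \<noteq> n) rf)" and ?v' = "wires (filter (\<lambda>i. i \<noteq> n) rf')"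
  note tys = slice_typing[OF tens.hyps] slice_typing[OF s']
  consider "n \<notin> set (k # rf)" | "n \<in> set rf" "k \<noteq> n" | "n \<in> set rf" "k = n" | "n \<notin> set rf" "k = n"
    by fastforce
  then show ?case
  proof cases
    case 1
    then have "n \<notin> set rf'" "k \<noteq> n" "n \<notin> set rf" using tys by auto
    then show ?thesis
      using slice_place_notin[OF slice.tens[OF tens.hyps] 1] slice.tens[OF tens.hyps]
      by (intro exI[of _ "s \<otimes> idc (C k)"]) (simp add: filter_neq_id)
  next
    case 2
    have "(s \<otimes> idc (C k)) \<bullet> place n (k # rf) =
        ((s \<bullet> place n rf) \<otimes> idc (C k)) \<bullet> (ident ?v \<otimes> \<tau> (C k) (C n))"
      using 2 tys by (simp add: place_neq slicing)
    also have "\<dots> \<leadsto> ((place n rf' \<bullet> (s' \<otimes> idc (C n))) \<otimes> idc (C k)) \<bullet> (ident ?v \<otimes> \<tau> (C k) (C n))"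
      using tys by (intro reds_vcomp_right reds_tens_right IH) auto
    also have "\<dots> = (place n rf' \<otimes> idc (C k)) \<bullet>
        ((ident ?v' \<otimes> \<tau> (C k) (C n)) \<bullet> (s' \<otimes> idc (C k) \<otimes> idc (C n)))"
      using tys slide[of s' "\<tau> (C k) (C n)"] slide'[of s' "\<tau> (C k) (C n)"] by (simp add: slicing)
    also have "\<dots> \<leadsto> place n (k # rf') \<bullet> (s' \<otimes> idc (C k) \<otimes> idc (C n))"
    proof (cases "n \<in> set rf'")
      case True
      with 2 tys show ?thesis by (simp add: place_neq slicing)
    next
      \<comment> \<open>The slice has erased the last copy of \<open>n\<close>, so
        \<open>place n rf'\<close> is an \<open>\<epsilon>\<close>. It meets the crossing left over
        from \<open>place_neq\<close>, which rule 10 removes.\<close>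
      case False
      have "(place n rf' \<otimes> idc (C k)) \<bullet>
        ((ident ?v' \<otimes> \<tau> (C k) (C n)) \<bullet> (s' \<otimes> idc (C k) \<otimes> idc (C n))) =
        ident (?v' @ [C k]) \<bullet> ((ident ?v' \<otimes> ((\<epsilon> (C n) \<otimes> idc (C k)) \<bullet> \<tau> (C k) (C n))) \<bullet>
          (s' \<otimes> idc (C k) \<otimes> idc (C n)))"
        using False tys by (simp add: place_notin slicing filter_neq_id)
      also have "\<dots> \<leadsto> ident (?v' @ [C k]) \<bullet> ((ident ?v' \<otimes> (idc (C k) \<otimes> \<epsilon> (C n))) \<bullet>
          (s' \<otimes> idc (C k) \<otimes> idc (C n)))"
        using tys by (intro reds_in_context) (auto intro: R_Delta.r10)
      also have "\<dots> = place n (k # rf') \<bullet> (s' \<otimes> idc (C k) \<otimes> idc (C n))"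
        using 2 False tys by (simp add: place_notin slicing filter_neq_id)
      finally show ?thesis .
    qed
    finally show ?thesis using 2 slice.tens[OF s'] by auto
  next
    case 3
    have "(s \<otimes> idc (C k)) \<bullet> place n (k # rf) =
        ((s \<bullet> place n rf) \<otimes> idc (C n)) \<bullet> (ident ?v \<otimes> \<delta> (C n))"
      using 3 tys by (simp add: place_dup slicing)
    also have "\<dots> \<leadsto> ((place n rf' \<bullet> (s' \<otimes> idc (C n))) \<otimes> idc (C n)) \<bullet> (ident ?v \<otimes> \<delta> (C n))"
      using tys by (intro reds_vcomp_right reds_tens_right IH) auto
    also have "\<dots> = (place n rf' \<otimes> idc (C n)) \<bullet>
        ((ident ?v' \<otimes> \<delta> (C n)) \<bullet> (s' \<otimes> idc (C n)))"
      using tys slide[of s' "\<delta> (C n)"] slide'[of s' "\<delta> (C n)"] by (simp add: slicing)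
    also have "\<dots> \<leadsto> place n (n # rf') \<bullet> (s' \<otimes> idc (C n))"
    proof (cases "n \<in> set rf'")
      case True
      with 3 tys show ?thesis by (simp add: place_dup slicing)
    next
      \<comment> \<open>Again the last copy of \<open>n\<close> in \<open>rf\<close> was erased; the
        \<open>\<epsilon>\<close> now meets the leftover \<open>\<delta>\<close>, and rule 4 cancels
        both.\<close>
      case False
      have "(place n rf' \<otimes> idc (C n)) \<bullet> ((ident ?v' \<otimes> \<delta> (C n)) \<bullet> (s' \<otimes> idc (C n))) =
        ident (?v' @ [C n]) \<bullet> ((ident ?v' \<otimes> ((\<epsilon> (C n) \<otimes> idc (C n)) \<bullet> \<delta> (C n))) \<bullet>
          (s' \<otimes> idc (C n)))"
        using False tys by (simp add: place_notin slicing filter_neq_id)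
      also have "\<dots> \<leadsto> ident (?v' @ [C n]) \<bullet> ((ident ?v' \<otimes> idc (C n)) \<bullet> (s' \<otimes> idc (C n)))"
        using tys by (intro reds_in_context) (auto intro: R_Delta.r4)
      also have "\<dots> = place n (n # rf') \<bullet> (s' \<otimes> idc (C n))"
        using False tys by (simp add: place_last slicing filter_neq_id)
      finally show ?thesis .
    qed
    finally show ?thesis using 3 s' by auto
  next
    case 4
    then have "n \<notin> set rf'" using tys by auto
    with 4 show ?thesis
      using tens.hyps tys
      by (intro exI[of _ s]) (simp add: place_last filter_neq_id)
  qed
qed

end

section \<open>Terms\<close>

datatype trm = Var nat | App two_cell "trm list"

abbreviation operations :: "two_cell set" where
  "operations \<equiv> {Conj, Disj, Top, Bot, Iota, Nu}"

text \<open>Structural cells act as diagonal, discard and symmetry in a category with finite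
  products, operations act freely. Concatenation and reversal have these meanings on lists of the
  length of the cell's source.\<close>

fun sem :: "two_cell \<Rightarrow> trm list \<Rightarrow> trm list" where
  "sem (Delta X) ts = ts @ ts"
| "sem (Eps X) ts = []"
| "sem (Tau X Y) ts = rev ts"
| "sem \<phi> ts = [App \<phi> ts]"

interpretation S: cell_semantics sem
proof
  fix xs :: "trm list" and c assume "length xs = length (cell_src c)"
  then show "length (sem c xs) = length (cell_tgt c)" by (cases c) auto
qed

lemma eval_rule:
  assumes "(s, t) \<in> R_Delta" "length xs = length (src s)"
  shows "S.eval s xs = S.eval t xs"
  using assms
proof (cases rule: R_Delta.cases)
  case (nat_tau_left \<phi> W S X)
  with assms(2) show ?thesis by (cases \<phi>) (auto simp: length_1 length_2 length_3)
next
  case (nat_tau_right \<phi> W S X)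
  with assms(2) show ?thesis by (cases \<phi>) (auto simp: length_1 length_2 length_3)
next
  case (nat_delta \<phi> W S)
  with assms(2) show ?thesis by (cases \<phi>) (auto simp: length_1 length_2 length_3)
next
  case (nat_eps \<phi> W S)
  with assms(2) show ?thesis by (cases \<phi>) (auto simp: length_1 length_2 length_3)
qed (use assms(2) in \<open>auto simp: length_1 length_2 length_3\<close>)

lemma eval_red_rule:
  "red_rule \<alpha> a b \<Longrightarrow> \<alpha> \<in> R_Delta \<Longrightarrow> length xs = length (src a) \<Longrightarrow> S.eval a xs = S.eval b xs"
proof (induction arbitrary: xs rule: red_rule.induct)
  case rule
  then show ?case using eval_rule[of "fst \<alpha>" "snd \<alpha>"] by simp
next
  case (tens_left a b c)
  then have "red R_Delta a b" by (auto simp: red_def)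
  with tens_left show ?case by (auto dest: red_parallel)
next
  case (tens_right a b c)
  then have "red R_Delta a b" by (auto simp: red_def)
  with tens_right show ?case by (auto dest: red_parallel)
next
  case (comp_left a b c)
  then have "red R_Delta a b" by (auto simp: red_def)
  with comp_left show ?case by (auto dest: red_parallel)
qed simp

lemma eval_reds: "a \<leadsto> b \<Longrightarrow> length xs = length (src a) \<Longrightarrow> S.eval a xs = S.eval b xs"
proof (induction rule: rtranclp_induct)
  case (step b b')
  then have "src a = src b" by (auto dest: reds_parallel)
  moreover from step obtain \<alpha> where "\<alpha> \<in> R_Delta" "red_rule \<alpha> b b'" by (auto simp: red_def)
  ultimately show ?case using step eval_red_rule by simp
qed simp

lemma abs_arrow_simps:
  "abs_arrow (DId w) = ident w" "abs_arrow (DCell c) = cell c"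
  "well_typed f \<Longrightarrow> well_typed g \<Longrightarrow> abs_arrow (DTens f g) = abs_arrow f \<otimes> abs_arrow g"
  "well_typed f \<Longrightarrow> well_typed g \<Longrightarrow> dsrc g = dtgt f \<Longrightarrow>
    abs_arrow (DComp g f) = abs_arrow g \<bullet> abs_arrow f"
  by (simp_all add: ident_def cell_def tens.abs_eq vcomp.abs_eq diag_eq.refl)

lemma src_tgt_abs_arrow [simp]:
  "well_typed f \<Longrightarrow> src (abs_arrow f) = dsrc f" "well_typed f \<Longrightarrow> tgt (abs_arrow f) = dtgt f"
  by (simp_all add: src.abs_eq tgt.abs_eq diag_eq.refl)

lemma abs_rep_arrow: "abs_arrow (rep_arrow a) = a"
  by (rule Quotient3_abs_rep[OF Quotient3_arrow])

section \<open>Canonical structural 2-arrows and the absorption of slices\<close>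

context
  fixes C :: "nat \<Rightarrow> one_cell"
begin

text \<open>\<open>spread n rf\<close> is meaningful only if all entries of \<open>rf\<close> are less than \<open>n\<close>.\<close>

fun spread :: "nat \<Rightarrow> nat list \<Rightarrow> arrow" where
  "spread 0 rf = ident []"
| "spread (Suc n) rf = place C n rf \<bullet> (spread n (filter (\<lambda>i. i \<noteq> n) rf) \<otimes> idc (C n))"

lemma filter_bound: "set rf \<subseteq> {..<Suc n} \<Longrightarrow> set (filter (\<lambda>i. i \<noteq> n) rf) \<subseteq> {..<n}"
  by auto

lemma spread_typing:
  "set rf \<subseteq> {..<n} \<Longrightarrow> src (spread n rf) = map C [0..<n] \<and> tgt (spread n rf) = wires C rf"
proof (induction n arbitrary: rf)
  case (Suc n)
  then show ?case using Suc.IH[OF filter_bound] by simp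
qed auto

text \<open>Induction on the wires, the last one first: \<open>slice_place\<close> carries the slice
  through the outermost placement, and the residue meets the \<open>spread\<close> of the remaining
  wires.\<close>

lemma slice_spread:
  "slice C s rf rf' \<Longrightarrow> set rf \<subseteq> {..<n} \<Longrightarrow> s \<bullet> spread n rf \<leadsto> spread n rf'"
proof (induction n arbitrary: s rf rf')
  case 0
  \<comment> \<open>Without wires the only slice is the identity.\<close>
  then show ?case by (auto elim: slice.cases)
next
  case (Suc n)
  let ?g = "filter (\<lambda>i. i \<noteq> n) rf" and ?g' = "filter (\<lambda>i. i \<noteq> n) rf'"
  obtain s' where s': "slice C s' ?g ?g'"
    and red: "s \<bullet> place C n rf \<leadsto> place C n rf' \<bullet> (s' \<otimes> idc (C n))"
    using slice_place[OF Suc.prems(1)] by blast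
  have sub: "set ?g \<subseteq> {..<n}" "set ?g' \<subseteq> {..<n}"
    using Suc.prems slice_typing[OF Suc.prems(1)] by (auto simp: subset_iff less_Suc_eq)
  note tys = slice_typing[OF s'] slice_typing[OF Suc.prems(1)] spread_typing[OF sub(1)]
    spread_typing[OF sub(2)]
  have "s \<bullet> spread (Suc n) rf = (s \<bullet> place C n rf) \<bullet> (spread n ?g \<otimes> idc (C n))"
    using tys by (simp add: vcomp_assoc)
  also have "\<dots> \<leadsto> (place C n rf' \<bullet> (s' \<otimes> idc (C n))) \<bullet> (spread n ?g \<otimes> idc (C n))"
    using tys by (intro reds_vcomp_right red) simp
  also have "\<dots> = place C n rf' \<bullet> ((s' \<bullet> spread n ?g) \<otimes> idc (C n))"
    using tys by (simp add: slicing)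
  also have "\<dots> \<leadsto> place C n rf' \<bullet> (spread n ?g' \<otimes> idc (C n))"
    using tys by (intro reds_vcomp_left reds_tens_right Suc.IH s' sub) simp
  finally show ?case by simp
qed

text \<open>Lets a \<open>spread\<close> be inserted before any structural 2-arrow on the inputs,
  ready to absorb it.\<close>

lemma spread_upt: "spread n (rev [0..<n]) = ident (map C [0..<n])"
  by (induction n) (simp_all add: place_last filter_neq_id wires_def)

inductive structural :: "arrow \<Rightarrow> nat list \<Rightarrow> nat list \<Rightarrow> bool" where
  slice: "slice C s (rev xs) (rev ys) \<Longrightarrow> structural s xs ys"
| comp: "structural s xs ys \<Longrightarrow> structural s' ys zs \<Longrightarrow> structural (s' \<bullet> s) xs zs"

lemma structural_typing:
  "structural s xs ys \<Longrightarrow> src s = map C xs \<and> tgt s = map C ys \<and> set ys \<subseteq> set xs"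
  by (induction rule: structural.induct) (auto dest!: slice_typing simp: wires_def)

lemma structural_ident: "structural (ident (map C xs)) xs xs"
  using structural.slice[OF slice.ident[of C "rev xs", folded wires_def]] by (simp add: wires_def)

lemma slice_tens_wires: "slice C s rf rf' \<Longrightarrow> slice C (s \<otimes> ident (wires C u)) (u @ rf) (u @ rf')"
proof (induction u)
  case (Cons k u)
  then show ?case using slice.tens[of C "s \<otimes> ident (wires C u)" "u @ rf" "u @ rf'" k]
    by (simp add: tens_assoc)
qed simp

lemma slice_wires_tens: "slice C s rf rf' \<Longrightarrow> slice C (ident (wires C u) \<otimes> s) (rf @ u) (rf' @ u)"
proof (induction rule: slice.induct)
  case (eps rf k)
  then show ?case using slice.eps[of C "rf @ u" k] by simp
next
  case (delta rf k)
  then show ?case using slice.delta[of C "rf @ u" k] by simp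
next
  case (tau rf l k)
  then show ?case using slice.tau[of C "rf @ u" l k] by simp
next
  case (ident rf)
  then show ?case using slice.ident[of C "rf @ u"] by simp
next
  case (tens s rf rf' k)
  then show ?case using slice.tens[OF tens.IH, of k] by (simp add: tens_assoc)
qed

lemma structural_tens_right:
  "structural s xs ys \<Longrightarrow> structural (s \<otimes> ident (map C zs)) (xs @ zs) (ys @ zs)"
proof (induction rule: structural.induct)
  case (slice s xs ys)
  then show ?case
    using slice_tens_wires[of s "rev xs" "rev ys" "rev zs"]
    by (auto intro: structural.slice simp: wires_def)
next
  case (comp s xs ys s' vs)
  then show ?case
    by (auto dest!: structural_typing[of s] structural_typing[of s'] simp: tens_vcomp_ident intro: structural.comp)
qed

lemma structural_tens_left:
  "structural s xs ys \<Longrightarrow> structural (ident (map C zs) \<otimes> s) (zs @ xs) (zs @ ys)"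
proof (induction rule: structural.induct)
  case (slice s xs ys)
  then show ?case
    using slice_wires_tens[of s "rev xs" "rev ys" "rev zs"]
    by (auto intro: structural.slice simp: wires_def)
next
  case (comp s xs ys s' vs)
  then show ?case
    by (auto dest!: structural_typing[of s] structural_typing[of s'] simp: ident_tens_vcomp intro: structural.comp)
qed

lemma structural_tens:
  assumes "structural s xs ys" "structural s' xs' ys'"
  shows "structural (s \<otimes> s') (xs @ xs') (ys @ ys')"
  using structural.comp[OF structural_tens_left[OF assms(2), of xs] structural_tens_right[OF assms(1), of ys']]
    slide[of s s'] structural_typing[OF assms(1)] structural_typing[OF assms(2)] by simp

text \<open>The slices of \<open>s\<close> are absorbed one after another. The result mentions the
  wiring \<open>ys\<close> but not \<open>s\<close>, so the way in which \<open>s\<close> was built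
  is forgotten.\<close>

lemma structural_spread:
  "structural s xs ys \<Longrightarrow> set xs \<subseteq> {..<n} \<Longrightarrow> s \<bullet> spread n (rev xs) \<leadsto> spread n (rev ys)"
proof (induction rule: structural.induct)
  case (slice s xs ys)
  then show ?case by (simp add: slice_spread)
next
  case (comp s xs ys s' zs)
  note tys = structural_typing[OF comp.hyps(1)] structural_typing[OF comp.hyps(2)]
  have sub: "set ys \<subseteq> {..<n}" using tys comp.prems by blast
  have "(s' \<bullet> s) \<bullet> spread n (rev xs) = s' \<bullet> (s \<bullet> spread n (rev xs))"
    using tys comp.prems by (simp add: vcomp_assoc spread_typing wires_def)
  also have "\<dots> \<leadsto> s' \<bullet> spread n (rev ys)"
    using tys comp by (intro reds_vcomp_left comp.IH) (auto simp: spread_typing)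
  also have "\<dots> \<leadsto> spread n (rev zs)" by (rule comp.IH(2)[OF sub])
  finally show ?case .
qed

section \<open>Forests of operations and their passage through 2-arrows\<close>

fun colour :: "trm \<Rightarrow> one_cell" where
  "colour (Var n) = C n"
| "colour (App c ts) = hd (cell_tgt c)"

fun leaves :: "trm \<Rightarrow> nat list" where
  "leaves (Var n) = [n]"
| "leaves (App c ts) = concat (map leaves ts)"

fun tree :: "trm \<Rightarrow> arrow" where
  "tree (Var n) = idc (C n)"
| "tree (App c ts) = cell c \<bullet> foldr (\<otimes>) (map tree ts) (ident [])"

fun wf_trm :: "trm \<Rightarrow> bool" where
  "wf_trm (Var n) \<longleftrightarrow> True"
| "wf_trm (App c ts) \<longleftrightarrow> c \<in> operations \<and> map colour ts = cell_src c \<and> (\<forall>t\<in>set ts. wf_trm t)"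

definition forest :: "trm list \<Rightarrow> arrow" where
  "forest ts = foldr (\<otimes>) (map tree ts) (ident [])"

abbreviation fringe :: "trm list \<Rightarrow> nat list" where
  "fringe ts \<equiv> concat (map leaves ts)"

abbreviation wf_trms :: "trm list \<Rightarrow> bool" where
  "wf_trms ts \<equiv> \<forall>t\<in>set ts. wf_trm t"

lemma forest_simps [simp]: "forest [] = ident []" "forest (t # ts) = tree t \<otimes> forest ts"
  by (simp_all add: forest_def)

lemma forest_append: "forest (ts @ us) = forest ts \<otimes> forest us"
  by (induction ts) (simp_all add: tens_assoc)

lemma tree_App: "tree (App c ts) = cell c \<bullet> forest ts"
  by (simp add: forest_def)

declare tree.simps(2) [simp del]

lemma forest_typing_aux:
  "(\<And>t. t \<in> set ts \<Longrightarrow> src (tree t) = map C (leaves t) \<and> tgt (tree t) = [colour t]) \<Longrightarrow>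
    src (forest ts) = map C (fringe ts) \<and> tgt (forest ts) = map colour ts"
  by (induction ts) auto

lemma tree_typing: "wf_trm t \<Longrightarrow> src (tree t) = map C (leaves t) \<and> tgt (tree t) = [colour t]"
proof (induction t)
  case (App c ts)
  then have "src (forest ts) = map C (fringe ts) \<and> tgt (forest ts) = map colour ts"
    by (intro forest_typing_aux) auto
  with App.prems show ?case by (auto simp: tree_App)
qed simp

lemma forest_typing:
  "wf_trms ts \<Longrightarrow> src (forest ts) = map C (fringe ts) \<and> tgt (forest ts) = map colour ts"
  by (rule forest_typing_aux) (simp add: tree_typing)

text \<open>The operations end up at the outputs, past \<open>a\<close>. The remainder
  \<open>s\<close> is left unspecified: by \<open>structural_spread\<close> only its wiring matters,
  and the two fringes determine it.\<close>

definition pushes :: "arrow \<Rightarrow> trm list \<Rightarrow> trm list \<Rightarrow> bool" where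
  "pushes a ts ts' \<longleftrightarrow> wf_trms ts \<and> wf_trms ts' \<and> src a = map colour ts \<and> tgt a = map colour ts' \<and>
    (\<exists>s. structural s (fringe ts) (fringe ts') \<and> a \<bullet> forest ts \<leadsto> forest ts' \<bullet> s)"

lemma pushes_ident: "wf_trms ts \<Longrightarrow> pushes (ident (map colour ts)) ts ts"
  using structural_ident[of "fringe ts"] forest_typing[of ts] unfolding pushes_def by force

lemma pushes_reds: "a \<leadsto> b \<Longrightarrow> pushes b ts ts' \<Longrightarrow> pushes a ts ts'"
  unfolding pushes_def using reds_parallel[of a b] reds_vcomp_right[of a b "forest ts"] forest_typing[of ts]
  by (auto intro: reds_trans)

lemma pushes_vcomp:
  assumes "pushes a ts ts'" "pushes b ts' ts''"
  shows "pushes (b \<bullet> a) ts ts''"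
proof -
  obtain s where s: "structural s (fringe ts) (fringe ts')" "a \<bullet> forest ts \<leadsto> forest ts' \<bullet> s"
    using assms(1) by (auto simp: pushes_def)
  obtain s' where s': "structural s' (fringe ts') (fringe ts'')" "b \<bullet> forest ts' \<leadsto> forest ts'' \<bullet> s'"
    using assms(2) by (auto simp: pushes_def)
  have p: "wf_trms ts" "wf_trms ts'" "wf_trms ts''" "src a = map colour ts"
      "tgt a = map colour ts'" "src b = map colour ts'" "tgt b = map colour ts''"
    using assms by (auto simp: pushes_def)
  note tys = p forest_typing[OF p(1)] forest_typing[OF p(2)] forest_typing[OF p(3)]
    structural_typing[OF s(1)] structural_typing[OF s'(1)]
  have "(b \<bullet> a) \<bullet> forest ts = b \<bullet> (a \<bullet> forest ts)" using tys by (simp add: vcomp_assoc)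
  also have "\<dots> \<leadsto> b \<bullet> (forest ts' \<bullet> s)" using tys by (intro reds_vcomp_left s) simp
  also have "\<dots> = (b \<bullet> forest ts') \<bullet> s" using tys by (simp add: vcomp_assoc)
  also have "\<dots> \<leadsto> (forest ts'' \<bullet> s') \<bullet> s" using tys by (intro reds_vcomp_right s') simp
  also have "\<dots> = forest ts'' \<bullet> (s' \<bullet> s)" using tys by (simp add: vcomp_assoc)
  finally show ?thesis
    unfolding pushes_def using tys structural.comp[OF s(1) s'(1)] by auto
qed

lemma pushes_tens:
  assumes "pushes a ts ts'" "pushes b us us'"
  shows "pushes (a \<otimes> b) (ts @ us) (ts' @ us')"
proof -
  obtain s where s: "structural s (fringe ts) (fringe ts')" "a \<bullet> forest ts \<leadsto> forest ts' \<bullet> s"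
    using assms(1) by (auto simp: pushes_def)
  obtain s' where s': "structural s' (fringe us) (fringe us')" "b \<bullet> forest us \<leadsto> forest us' \<bullet> s'"
    using assms(2) by (auto simp: pushes_def)
  have p: "wf_trms ts" "wf_trms ts'" "wf_trms us" "wf_trms us'" "src a = map colour ts"
      "tgt a = map colour ts'" "src b = map colour us" "tgt b = map colour us'"
    using assms by (auto simp: pushes_def)
  note tys = p forest_typing[OF p(1)] forest_typing[OF p(2)] forest_typing[OF p(3)]
    forest_typing[OF p(4)] structural_typing[OF s(1)] structural_typing[OF s'(1)]
  have "(a \<otimes> b) \<bullet> forest (ts @ us) = (a \<bullet> forest ts) \<otimes> (b \<bullet> forest us)"
    using tys by (simp add: forest_append interchange)
  also have "\<dots> \<leadsto> (forest ts' \<bullet> s) \<otimes> (forest us' \<bullet> s')"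
    by (rule reds_trans[OF reds_tens_left[OF s'(2)] reds_tens_right[OF s(2)]])
  also have "\<dots> = forest (ts' @ us') \<bullet> (s \<otimes> s')"
    using tys by (simp add: forest_append interchange)
  finally show ?thesis
    unfolding pushes_def using tys structural_tens[OF s(1) s'(1)] by auto
qed

lemma pushes_operation:
  assumes "c \<in> operations" "wf_trms ts" "map colour ts = cell_src c"
  shows "pushes (cell c) ts [App c ts]"
proof -
  have "cell c \<bullet> forest ts = forest [App c ts] \<bullet> ident (map C (fringe ts))"
    using assms forest_typing[OF assms(2)] by (simp add: tree_App)
  moreover have "cell_tgt c = [hd (cell_tgt c)]" using assms(1) by auto
  ultimately show ?thesis
    unfolding pushes_def using assms structural_ident[of "fringe ts"] by auto
qed

text \<open>Used with \<open>a\<close> a structural cell: detaching the root of one argument and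
  composing it with \<open>a\<close> exposes the left side of a naturality rule.\<close>

lemma pushes_App:
  assumes "pushes (a \<bullet> (ident (map colour us) \<otimes> cell c \<otimes> ident (map colour vs))) (us @ ts @ vs) ws"
    and "wf_trm (App c ts)" "src a = map colour (us @ App c ts # vs)"
  shows "pushes a (us @ App c ts # vs) ws"
proof -
  have wf: "wf_trms us" "wf_trms ts" "wf_trms vs" "map colour ts = cell_src c"
    using assms by (auto simp: pushes_def)
  have c: "cell_tgt c = [hd (cell_tgt c)]" using assms(2) by auto
  note tys = forest_typing[OF wf(1)] forest_typing[OF wf(2)] forest_typing[OF wf(3)]
  have "(ident (map colour us) \<otimes> cell c \<otimes> ident (map colour vs)) \<bullet> forest (us @ ts @ vs) =
      forest us \<otimes> (cell c \<bullet> forest ts) \<otimes> forest vs"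
    using tys wf by (simp add: forest_append tens_assoc interchange[symmetric])
  also have "\<dots> = forest (us @ App c ts # vs)"
    by (simp add: forest_append tree_App tens_assoc)
  finally have "(a \<bullet> (ident (map colour us) \<otimes> cell c \<otimes> ident (map colour vs))) \<bullet> forest (us @ ts @ vs) =
      a \<bullet> forest (us @ App c ts # vs)"
    using tys wf c assms(3) by (simp add: vcomp_assoc forest_append)
  with assms c show ?thesis
    unfolding pushes_def by auto
qed

text \<open>The assumption on single terms will be the induction hypothesis of an induction over
  terms; the analogues for \<open>\<tau>r\<close>, \<open>\<delta>w\<close> and
  \<open>\<epsilon>w\<close> have the same purpose.\<close>

lemma pushes_\<tau>l:
  "wf_trms ts \<Longrightarrow> wf_trm x \<Longrightarrow> (\<And>t. t \<in> set ts \<Longrightarrow> pushes (\<tau> (colour t) (colour x)) [t, x] [x, t]) \<Longrightarrow>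
    pushes (\<tau>l (map colour ts) (colour x)) (ts @ [x]) (x # ts)"
proof (induction ts rule: induct_list012)
  case 1
  then show ?case using pushes_ident[of "[x]"] by simp
next
  case (3 t u ts)
  have "pushes (idc (colour t) \<otimes> \<tau>l (map colour (u # ts)) (colour x)) ([t] @ ((u # ts) @ [x])) ([t] @ (x # u # ts))"
    using 3 pushes_ident[of "[t]"] by (intro pushes_tens) auto
  moreover have "pushes (\<tau> (colour t) (colour x) \<otimes> ident (map colour (u # ts))) ([t, x] @ (u # ts)) ([x, t] @ (u # ts))"
    using 3 by (intro pushes_tens pushes_ident) auto
  ultimately show ?case using pushes_vcomp by simp
qed simp

lemma pushes_\<tau>r:
  "wf_trms ts \<Longrightarrow> wf_trm x \<Longrightarrow> (\<And>t. t \<in> set ts \<Longrightarrow> pushes (\<tau> (colour x) (colour t)) [x, t] [t, x]) \<Longrightarrow>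
    pushes (\<tau>r (colour x) (map colour ts)) (x # ts) (ts @ [x])"
proof (induction ts rule: induct_list012)
  case 1
  then show ?case using pushes_ident[of "[x]"] by simp
next
  case (3 t u ts)
  have "pushes (idc (colour t) \<otimes> \<tau>r (colour x) (map colour (u # ts))) ([t] @ (x # u # ts)) ([t] @ ((u # ts) @ [x]))"
    using 3 pushes_ident[of "[t]"] by (intro pushes_tens) auto
  moreover have "pushes (\<tau> (colour x) (colour t) \<otimes> ident (map colour (u # ts))) ([x, t] @ (u # ts)) ([t, x] @ (u # ts))"
    using 3 by (intro pushes_tens pushes_ident) auto
  ultimately show ?case using pushes_vcomp by simp
qed simp

text \<open>Induction on the left term only: naturality replaces the crossing with its root by
  crossings of its arguments with the same variable.\<close>

lemma pushes_\<tau>_Var: "wf_trm t \<Longrightarrow> pushes (\<tau> (colour t) (C n)) [t, Var n] [Var n, t]"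
proof (induction t)
  case (Var m)
  show ?case
    using structural.slice[of "\<tau> (C m) (C n)" "[m, n]" "[n, m]"] slice.tau[of C "[]" m n]
    by (auto simp: pushes_def)
next
  case (App c ts)
  then have c: "cell_tgt c = [colour (App c ts)]" "c \<in> operations" "map colour ts = cell_src c" "wf_trms ts"
    by auto
  have "pushes (\<tau>l (map colour ts) (C n)) (ts @ [Var n]) ([Var n] @ ts)"
    using pushes_\<tau>l[of ts "Var n"] App by auto
  moreover have "pushes (idc (C n) \<otimes> cell c) ([Var n] @ ts) ([Var n] @ [App c ts])"
    using pushes_ident[of "[Var n]"] c by (intro pushes_tens pushes_operation) auto
  ultimately have "pushes ((idc (C n) \<otimes> cell c) \<bullet> \<tau>l (map colour ts) (C n)) (ts @ [Var n]) [Var n, App c ts]"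
    using pushes_vcomp by force
  then have "pushes (\<tau> (colour (App c ts)) (C n) \<bullet> (cell c \<otimes> idc (C n))) (ts @ [Var n]) [Var n, App c ts]"
    using c by (intro pushes_reds[OF reds_rule[OF R_Delta.nat_tau_left]]) auto
  then show ?case
    using pushes_App[of "\<tau> (colour (App c ts)) (C n)" "[]" c "[Var n]" ts] App.prems by simp
qed

text \<open>Now the right term is peeled for a fixed left one, with \<open>pushes_\<tau>_Var\<close>
  as base case. Each of the two inductions thus runs over a single term.\<close>

lemma pushes_\<tau>: "wf_trm u \<Longrightarrow> wf_trm t \<Longrightarrow> pushes (\<tau> (colour t) (colour u)) [t, u] [u, t]"
proof (induction u)
  case (Var n)
  then show ?case by (simp add: pushes_\<tau>_Var)
next
  case (App c us)
  then have c: "cell_tgt c = [colour (App c us)]" "c \<in> operations" "map colour us = cell_src c" "wf_trms us"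
    by auto
  have "pushes (\<tau>r (colour t) (map colour us)) ([t] @ us) (us @ [t])"
    using pushes_\<tau>r[of us t] App by auto
  moreover have "pushes (cell c \<otimes> idc (colour t)) (us @ [t]) ([App c us] @ [t])"
    using pushes_ident[of "[t]"] c App.prems by (intro pushes_tens pushes_operation) auto
  ultimately have "pushes ((cell c \<otimes> idc (colour t)) \<bullet> \<tau>r (colour t) (map colour us)) ([t] @ us) [App c us, t]"
    using pushes_vcomp by force
  then have "pushes (\<tau> (colour t) (colour (App c us)) \<bullet> (idc (colour t) \<otimes> cell c)) ([t] @ us) [App c us, t]"
    using c by (intro pushes_reds[OF reds_rule[OF R_Delta.nat_tau_right]]) auto
  then show ?case
    using pushes_App[of "\<tau> (colour t) (colour (App c us))" "[t]" c "[]" us] App.prems by simp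
qed

lemma pushes_\<delta>w:
  "wf_trms ts \<Longrightarrow> (\<And>t. t \<in> set ts \<Longrightarrow> pushes (\<delta> (colour t)) [t] [t, t]) \<Longrightarrow>
    pushes (\<delta>w (map colour ts)) ts (ts @ ts)"
proof (induction ts rule: induct_list012)
  case 1
  then show ?case using pushes_ident[of "[]"] by simp
next
  case (3 t u ts)
  have "pushes (\<delta> (colour t) \<otimes> \<delta>w (map colour (u # ts))) ([t] @ (u # ts)) ([t, t] @ ((u # ts) @ (u # ts)))"
    using 3 by (intro pushes_tens) auto
  moreover have "pushes (idc (colour t) \<otimes> \<tau>r (colour t) (map colour (u # ts)) \<otimes> ident (map colour (u # ts)))
      (([t] @ (t # u # ts)) @ (u # ts)) (([t] @ ((u # ts) @ [t])) @ (u # ts))"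
    using 3 pushes_ident[of "[t]"] by (intro pushes_tens pushes_ident pushes_\<tau>r pushes_\<tau>) auto
  ultimately show ?case using pushes_vcomp by simp
qed simp

text \<open>Naturality leaves \<open>\<delta>w\<close>, which also crosses copies of the arguments;
  this is why crossings are treated before duplication.\<close>

lemma pushes_\<delta>: "wf_trm t \<Longrightarrow> pushes (\<delta> (colour t)) [t] [t, t]"
proof (induction t)
  case (Var n)
  show ?case
    using structural.slice[of "\<delta> (C n)" "[n]" "[n, n]"] slice.delta[of C "[]" n]
    by (auto simp: pushes_def)
next
  case (App c ts)
  then have c: "cell_tgt c = [colour (App c ts)]" "c \<in> operations" "map colour ts = cell_src c" "wf_trms ts"
    by auto
  have "pushes (\<delta>w (map colour ts)) ts (ts @ ts)"
    using App by (intro pushes_\<delta>w) auto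
  moreover have "pushes (cell c \<otimes> cell c) (ts @ ts) ([App c ts] @ [App c ts])"
    using c by (intro pushes_tens pushes_operation) auto
  ultimately have "pushes ((cell c \<otimes> cell c) \<bullet> \<delta>w (map colour ts)) ts [App c ts, App c ts]"
    using pushes_vcomp by force
  then have "pushes (\<delta> (colour (App c ts)) \<bullet> cell c) ts [App c ts, App c ts]"
    using c by (intro pushes_reds[OF reds_rule[OF R_Delta.nat_delta]]) auto
  then show ?case
    using pushes_App[of "\<delta> (colour (App c ts))" "[]" c "[]" ts] App.prems by simp
qed

lemma pushes_\<epsilon>w:
  "wf_trms ts \<Longrightarrow> (\<And>t. t \<in> set ts \<Longrightarrow> pushes (\<epsilon> (colour t)) [t] []) \<Longrightarrow>
    pushes (\<epsilon>w (map colour ts)) ts []"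
proof (induction ts rule: induct_list012)
  case 1
  then show ?case using pushes_ident[of "[]"] by simp
next
  case (3 t u ts)
  then show ?case using pushes_tens[of "\<epsilon> (colour t)" "[t]" "[]" "\<epsilon>w (map colour (u # ts))" "u # ts" "[]"]
    by simp
qed simp

lemma pushes_\<epsilon>: "wf_trm t \<Longrightarrow> pushes (\<epsilon> (colour t)) [t] []"
proof (induction t)
  case (Var n)
  show ?case
    using structural.slice[of "\<epsilon> (C n)" "[n]" "[]"] slice.eps[of C "[]" n]
    by (auto simp: pushes_def)
next
  case (App c ts)
  then have c: "cell_tgt c = [colour (App c ts)]" "c \<in> operations" "map colour ts = cell_src c" "wf_trms ts"
    by auto
  have "pushes (\<epsilon>w (map colour ts)) ts []"
    using App by (intro pushes_\<epsilon>w) auto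
  then have "pushes (\<epsilon> (colour (App c ts)) \<bullet> cell c) ts []"
    using c by (intro pushes_reds[OF reds_rule[OF R_Delta.nat_eps]]) auto
  then show ?case
    using pushes_App[of "\<epsilon> (colour (App c ts))" "[]" c "[]" ts] App.prems by simp
qed

lemma pushes_cell:
  assumes "wf_trms ts" "map colour ts = cell_src c"
  shows "pushes (cell c) ts (sem c ts)"
proof (cases "c \<in> operations")
  case True
  then show ?thesis using pushes_operation[OF True assms] by auto
next
  case False
  then show ?thesis
    using assms pushes_\<delta> pushes_\<epsilon> pushes_\<tau> by (cases c) (auto simp: map_eq_Cons_conv)
qed

text \<open>\<open>pushes\<close> is closed under both compositions, so the cells decide. The pushed
  list is thereby identified with the term interpretation.\<close>

lemma pushes_run:
  "well_typed f \<Longrightarrow> wf_trms ts \<Longrightarrow> map colour ts = dsrc f \<Longrightarrow> pushes (abs_arrow f) ts (run sem f ts)"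
proof (induction f arbitrary: ts)
  case (DId w)
  then show ?case using pushes_ident[of ts] by (simp add: abs_arrow_simps)
next
  case (DCell c)
  then show ?case by (simp add: abs_arrow_simps pushes_cell)
next
  case (DComp g f)
  then have f: "pushes (abs_arrow f) ts (run sem f ts)" by simp
  have "wf_trms (run sem f ts)" "map colour (run sem f ts) = dsrc g"
    using f DComp.prems(1) by (simp_all add: pushes_def)
  then have "pushes (abs_arrow g) (run sem f ts) (run sem g (run sem f ts))"
    using DComp.prems(1) by (intro DComp.IH) simp_all
  with f show ?case using DComp.prems by (auto simp: abs_arrow_simps intro: pushes_vcomp)
next
  case (DTens f g)
  let ?l = "take (length (dsrc f)) ts" and ?r = "drop (length (dsrc f)) ts"
  have "pushes (abs_arrow f) ?l (run sem f ?l)" "pushes (abs_arrow g) ?r (run sem g ?r)"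
    using DTens.prems
    by (intro DTens.IH; auto simp flip: take_map drop_map dest: in_set_takeD in_set_dropD)+
  from pushes_tens[OF this] show ?case using DTens.prems by (simp add: abs_arrow_simps)
qed

section \<open>Normal forms and confluence\<close>

definition normal_form :: "nat \<Rightarrow> trm list \<Rightarrow> arrow" where
  "normal_form n ts = forest ts \<bullet> spread n (rev (fringe ts))"

lemma fringe_Var: "fringe (map Var ns) = ns"
  by (induction ns) simp_all

lemma forest_Var: "forest (map Var ns) = ident (map C ns)"
  by (induction ns) simp_all

lemma reds_normal_form_aux:
  assumes "src a = map C [0..<n]"
  shows "a \<leadsto> normal_form n (S.eval a (map Var [0..<n]))"
proof -
  let ?vs = "map Var [0..<n]" and ?ts = "S.eval a (map Var [0..<n])"
  have wf: "wf_trms ?vs" "map colour ?vs = src a" using assms by (auto simp: comp_def)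
  then have p: "pushes a ?vs ?ts"
    using pushes_run[of "rep_arrow a" ?vs] by (simp add: S.eval_def abs_rep_arrow)
  then obtain s where s: "structural s [0..<n] (fringe ?ts)" "a \<bullet> forest ?vs \<leadsto> forest ?ts \<bullet> s"
    by (auto simp: pushes_def fringe_Var simp del: map_map)
  have "wf_trms ?ts" using p by (simp add: pushes_def)
  note tys = forest_typing[OF this] structural_typing[OF s(1)]
  \<comment> \<open>A forest of variables is an identity, so pushing can start from any
    2-arrow.\<close>
  have "a = a \<bullet> forest ?vs" using assms by (simp add: forest_Var)
  also have "\<dots> \<leadsto> forest ?ts \<bullet> s" by (rule s)
  \<comment> \<open>The inserted \<open>spread\<close> is an identity by \<open>spread_upt\<close>;
    it seeds the absorption of \<open>s\<close>.\<close>
  also have "\<dots> = forest ?ts \<bullet> (s \<bullet> spread n (rev [0..<n]))"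
    using tys by (simp add: spread_upt)
  also have "\<dots> \<leadsto> forest ?ts \<bullet> spread n (rev (fringe ?ts))"
    using tys s by (intro reds_vcomp_left structural_spread) (auto simp: spread_typing)
  finally show ?thesis by (simp add: normal_form_def)
qed

end

lemma reds_normal_form:
  "a \<leadsto> normal_form (\<lambda>i. src a ! i) (length (src a)) (S.eval a (map Var [0..<length (src a)]))"
  by (rule reds_normal_form_aux) (simp add: map_nth)

lemma confluent_R_Delta: "confluent R_Delta"
  unfolding confluent_def
proof (rule confluentpI)
  fix a b c assume *: "a \<leadsto> b" "a \<leadsto> c"
  let ?vs = "map Var [0..<length (src a)]"
  have "src b = src a" "src c = src a"
    using reds_parallel[OF *(1)] reds_parallel[OF *(2)] by simp_all
  moreover have "S.eval b ?vs = S.eval a ?vs" "S.eval c ?vs = S.eval a ?vs"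
    using eval_reds[OF *(1), of ?vs] eval_reds[OF *(2), of ?vs] by simp_all
  ultimately show "\<exists>d. b \<leadsto> d \<and> c \<leadsto> d"
    using reds_normal_form[of b] reds_normal_form[of c] by auto
qed

theorem theorem1p4p16: "terminating R_Delta \<and> confluent R_Delta"
  using terminating_R_Delta confluent_R_Delta ..

end
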